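(* Let $\gamma>0$ and let $g_{2,\gamma}(t)=\left(\frac{\pi\gamma}{2}\right)^{1/2}\frac{1}{\cosh \pi\gamma t}$ for $t\in\mathbb{R}$. Then for all $a>0$, $b>0$ with $ab<1$, the triple $(g_{2,\gamma},a,b)$ is a Gabor frame, i.e. there exist constants $A>0$ and $B<\infty$ such that for all $f\in L^2(\mathbb{R})$ $$A\|f\|^2\le \sum_{n,m\in\mathbb{Z}}\left|\langle f,(g_{2,\gamma})_{na,mb}\rangle\right|^2\le B\|f\|^2 .$$
   Context: For $g\in L^2(\mathbb{R})$ and $x,y\in\mathbb{R}$, the time-frequency shifted function $g_{x,y}$ is defined by $g_{x,y}(t)=e^{2\pi i y t}g(t-x)$, $t\in\mathbb{R}$. Here $\|\cdot\|$ and $\langle\cdot,\cdot\rangle$ are the standard norm and inner product of $L^2(\mathbb{R})$ (complex-valued functions). *)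

theory Defs
  imports "HOL-Analysis.Analysis"
begin

text \<open>Elements of L2(R) are represented by functions rather than by classes modulo
  almost-everywhere equality; the norm and inner product below do not depend on the
  representative.\<close>

definition L2 :: "(real \<Rightarrow> complex) set" where
  "L2 = {f. f \<in> borel_measurable lebesgue \<and> integrable lebesgue (\<lambda>t. (cmod (f t))\<^sup>2)}"

definition L2_norm :: "(real \<Rightarrow> complex) \<Rightarrow> real" where
  "L2_norm f = sqrt (integral\<^sup>L lebesgue (\<lambda>t. (cmod (f t))\<^sup>2))"

definition L2_inner :: "(real \<Rightarrow> complex) \<Rightarrow> (real \<Rightarrow> complex) \<Rightarrow> complex" where
  "L2_inner f g = integral\<^sup>L lebesgue (\<lambda>t. f t * cnj (g t))"

definition tf_shift :: "(real \<Rightarrow> complex) \<Rightarrow> real \<Rightarrow> real \<Rightarrow> real \<Rightarrow> complex" where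
  "tf_shift g x y t = exp (2 * of_real pi * \<i> * of_real y * of_real t) * g (t - x)"

text \<open>The summability clause makes the double series a genuine (finite) sum: \<open>infsum\<close> is 0
  for a family of nonnegative reals that is not summable.\<close>

definition gabor_frame :: "(real \<Rightarrow> complex) \<Rightarrow> real \<Rightarrow> real \<Rightarrow> bool" where
  "gabor_frame g a b \<longleftrightarrow>
     g \<in> L2 \<and>
     (\<exists>A B::real. A > 0 \<and>
       (\<forall>f\<in>L2.
          (\<lambda>(n::int, m::int). (cmod (L2_inner f (tf_shift g (of_int n * a) (of_int m * b))))\<^sup>2)
            summable_on UNIV \<and>
          A * (L2_norm f)\<^sup>2 \<le>
            (\<Sum>\<^sub>\<infinity>(n::int, m::int)\<in>UNIV.
               (cmod (L2_inner f (tf_shift g (of_int n * a) (of_int m * b))))\<^sup>2) \<and>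
          (\<Sum>\<^sub>\<infinity>(n::int, m::int)\<in>UNIV.
               (cmod (L2_inner f (tf_shift g (of_int n * a) (of_int m * b))))\<^sup>2)
            \<le> B * (L2_norm f)\<^sup>2))"

definition sech_window :: "real \<Rightarrow> real \<Rightarrow> complex" where
  "sech_window \<gamma> t = of_real (sqrt (pi * \<gamma> / 2) * (1 / cosh (pi * \<gamma> * t)))"

end

theory Submission
  imports Defs
begin

text \<open>On functions supported in finitely many periods of length \<open>1/b\<close>, Parseval's identity
  turns the sum over the modulations into
  \<open>1/b\<close> times the integral over \<open>0 \<le> t < 1/b\<close> of
  \<open>\<Sum>n. \<bar>\<Sum>k. f (t + k/b) g (t + k/b - na)\<bar>\<^sup>2\<close>, so the frame bounds reduce to bounds, uniform in \<open>t\<close>,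
  for the matrices \<open>sech (\<pi>\<gamma>(t + k/b - na))\<close>. The upper bound is Schur's test. For the lower bound
  keep, for each \<open>k\<close>, only the \<open>n\<close> for which \<open>na\<close> is nearest to \<open>t + k/b\<close>; as \<open>a < 1/b\<close>, these \<open>n\<close> are
  distinct and \<open>na\<close> is off by at most \<open>a/2\<close>, less than half the spacing \<open>1/b\<close>. Since
  \<open>sech (x - y) = 2 e\<^sup>x e\<^sup>y / (e\<^sup>2\<^sup>x + e\<^sup>2\<^sup>y)\<close>, the resulting square
  matrix is a Cauchy matrix up to diagonal factors. Its explicit inverse decays exponentially off the
  diagonal, because each node between \<open>k\<close> and \<open>n\<close> costs at most a factor \<open>e\<^sup>2\<^sup>d\<close>
  (\<open>d\<close> the displacement) against the decay \<open>e\<^sup>-\<^sup>l\<close> (\<open>l\<close> the spacing), and \<open>2d < l\<close>.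
  Schur's test applied to the inverse gives the lower bound.\<close>

section \<open>Cauchy matrices\<close>

text \<open>Splitting at \<open>k\<close> leaves two geometric series; the bound is uniform in
  \<open>J\<close> and \<open>k\<close>, as the Schur tests below require.\<close>

lemma sum_power_abs_diff_le:
  fixes r :: real and J :: "int set"
  assumes "0 \<le> r" "r < 1" "finite J"
  shows "(\<Sum>m\<in>J. r ^ nat \<bar>m - k\<bar>) \<le> 2 / (1 - r)"
proof -
  have geo: "(\<Sum>i\<in>N. r ^ i) \<le> 1 / (1 - r)" if "finite N" for N :: "nat set"
    using sum_le_suminf[OF summable_geometric that, of r] suminf_geometric[of r] assms by auto
  define J1 where "J1 = {m\<in>J. m \<ge> k}"
  define J2 where "J2 = {m\<in>J. m < k}"
  have fin: "finite J1" "finite J2" using assms by (auto simp: J1_def J2_def)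
  have J: "J = J1 \<union> J2" "J1 \<inter> J2 = {}" by (auto simp: J1_def J2_def)
  have inj: "inj_on (\<lambda>m. nat \<bar>m - k\<bar>) J1" "inj_on (\<lambda>m. nat \<bar>m - k\<bar>) J2"
    by (auto simp: J1_def J2_def inj_on_def)
  have "(\<Sum>m\<in>J. r ^ nat \<bar>m - k\<bar>) = (\<Sum>m\<in>J1. r ^ nat \<bar>m - k\<bar>) + (\<Sum>m\<in>J2. r ^ nat \<bar>m - k\<bar>)"
    using J fin by (simp add: sum.union_disjoint)
  also have "\<dots> = (\<Sum>i\<in>(\<lambda>m. nat \<bar>m - k\<bar>) ` J1. r ^ i) + (\<Sum>i\<in>(\<lambda>m. nat \<bar>m - k\<bar>) ` J2. r ^ i)"
    using inj by (simp add: sum.reindex)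
  also have "\<dots> \<le> 1 / (1 - r) + 1 / (1 - r)"
    using fin by (intro add_mono geo) auto
  finally show ?thesis by simp
qed

text \<open>Cauchy-Schwarz after splitting each weight \<open>\<bar>M n k\<bar>\<close> into two
  square roots: one factor gives a row sum, and summing the other over \<open>n\<close> gives a
  column sum.\<close>

lemma schur_test:
  fixes M :: "'i \<Rightarrow> 'k \<Rightarrow> real" and c :: "'k \<Rightarrow> complex"
  assumes row: "\<And>n. n \<in> F \<Longrightarrow> (\<Sum>k\<in>K. \<bar>M n k\<bar>) \<le> R"
    and col: "\<And>k. k \<in> K \<Longrightarrow> (\<Sum>n\<in>F. \<bar>M n k\<bar>) \<le> S"
    and R: "0 \<le> R"
  shows "(\<Sum>n\<in>F. (cmod (\<Sum>k\<in>K. of_real (M n k) * c k))\<^sup>2) \<le> R * S * (\<Sum>k\<in>K. (cmod (c k))\<^sup>2)"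
proof -
  have "(cmod (\<Sum>k\<in>K. of_real (M n k) * c k))\<^sup>2 \<le> R * (\<Sum>k\<in>K. \<bar>M n k\<bar> * (cmod (c k))\<^sup>2)"
    if n: "n \<in> F" for n
  proof -
    have "cmod (\<Sum>k\<in>K. of_real (M n k) * c k) \<le> (\<Sum>k\<in>K. sqrt \<bar>M n k\<bar> * (sqrt \<bar>M n k\<bar> * cmod (c k)))"
      by (rule sum_norm_le) (simp add: norm_mult flip: mult.assoc)
    then have "(cmod (\<Sum>k\<in>K. of_real (M n k) * c k))\<^sup>2 \<le> (\<Sum>k\<in>K. sqrt \<bar>M n k\<bar> * (sqrt \<bar>M n k\<bar> * cmod (c k)))\<^sup>2"
      by (intro power_mono) auto
    also have "\<dots> \<le> (\<Sum>k\<in>K. (sqrt \<bar>M n k\<bar>)\<^sup>2) * (\<Sum>k\<in>K. (sqrt \<bar>M n k\<bar> * cmod (c k))\<^sup>2)"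
      by (rule Cauchy_Schwarz_ineq_sum)
    also have "\<dots> = (\<Sum>k\<in>K. \<bar>M n k\<bar>) * (\<Sum>k\<in>K. \<bar>M n k\<bar> * (cmod (c k))\<^sup>2)"
      by (simp add: power_mult_distrib)
    also have "\<dots> \<le> R * (\<Sum>k\<in>K. \<bar>M n k\<bar> * (cmod (c k))\<^sup>2)"
      by (intro mult_right_mono row n sum_nonneg) auto
    finally show ?thesis .
  qed
  then have "(\<Sum>n\<in>F. (cmod (\<Sum>k\<in>K. of_real (M n k) * c k))\<^sup>2)
      \<le> (\<Sum>n\<in>F. R * (\<Sum>k\<in>K. \<bar>M n k\<bar> * (cmod (c k))\<^sup>2))"
    by (rule sum_mono)
  also have "\<dots> = R * (\<Sum>k\<in>K. (\<Sum>n\<in>F. \<bar>M n k\<bar>) * (cmod (c k))\<^sup>2)"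
    by (simp add: sum_distrib_right sum.swap[of _ F K] flip: sum_distrib_left)
  also have "\<dots> \<le> R * (\<Sum>k\<in>K. S * (cmod (c k))\<^sup>2)"
    by (intro mult_left_mono sum_mono mult_right_mono col R) auto
  finally show ?thesis by (simp add: sum_distrib_left mult.assoc)
qed

text \<open>Both sides are polynomials of degree below \<open>card J\<close> that agree at the
  \<open>card J\<close> nodes.\<close>

lemma lagrange_interpolation:
  fixes x :: "'i \<Rightarrow> 'a :: field"
  assumes "finite J" "inj_on x J" "degree p < card J"
  shows "poly p w = (\<Sum>n\<in>J. poly p (x n) * (\<Prod>m\<in>J - {n}. (w - x m) / (x n - x m)))"
proof -
  define q where "q = (\<Sum>n\<in>J. smult (poly p (x n)) (\<Prod>m\<in>J - {n}. smult (1 / (x n - x m)) [:- x m, 1:]))"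
  have pq: "poly q w = (\<Sum>n\<in>J. poly p (x n) * (\<Prod>m\<in>J - {n}. (w - x m) / (x n - x m)))" for w
    unfolding q_def poly_sum poly_smult poly_prod
    by (intro sum.cong arg_cong2[where f = "(*)"] prod.cong) simp_all
  have "p = q"
  proof (rule poly_eqI_degree)
    fix z assume "z \<in> x ` J"
    then obtain k where k: "k \<in> J" "z = x k" by auto
    have "(\<Prod>m\<in>J - {n}. (x k - x m) / (x n - x m)) = (if n = k then 1 else 0)" if n: "n \<in> J" for n
    proof (cases "n = k")
      case True
      have "(x k - x m) / (x k - x m) = 1" if "m \<in> J - {k}" for m
      proof -
        have "x k \<noteq> x m" using that inj_onD[OF assms(2) _ k(1), of m] by auto
        then show ?thesis by simp
      qed
      then have "(\<Prod>m\<in>J - {k}. (x k - x m) / (x k - x m)) = 1"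
        by (rule prod.neutral[OF ballI])
      with True show ?thesis by simp
    next
      case False
      then have "k \<in> J - {n}" using k by auto
      then have "(\<Prod>m\<in>J - {n}. (x k - x m) / (x n - x m)) = 0"
        using assms(1) by (intro prod_zero) auto
      with False show ?thesis by simp
    qed
    then have "poly q z = (\<Sum>n\<in>J. poly p (x n) * (if n = k then 1 else 0))"
      unfolding pq k(2) by (intro sum.cong) simp_all
    also have "\<dots> = (\<Sum>n\<in>J. if n = k then poly p (x n) else 0)"
      by (intro sum.cong) auto
    finally show "poly p z = poly q z"
      using k assms(1) by simp
  next
    show "card (x ` J) > degree p" using assms by (simp add: card_image)
    have "degree (\<Prod>m\<in>J - {n}. smult (1 / (x n - x m)) [:- x m, 1:]) \<le> card J - 1" if "n \<in> J" for n
    proof -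
      have "degree (\<Prod>m\<in>J - {n}. smult (1 / (x n - x m)) [:- x m, 1:])
          \<le> (\<Sum>m\<in>J - {n}. degree (smult (1 / (x n - x m)) [:- x m, 1:]))"
        using degree_prod_sum_le[of "J - {n}" "\<lambda>m. smult (1 / (x n - x m)) [:- x m, 1:]"] assms(1)
        by (simp add: o_def)
      also have "\<dots> \<le> (\<Sum>m\<in>J - {n}. 1)"
        by (rule sum_mono, rule order_trans[OF degree_smult_le]) simp
      finally show ?thesis using that assms(1) by simp
    qed
    then have "degree (smult c (\<Prod>m\<in>J - {n}. smult (1 / (x n - x m)) [:- x m, 1:])) \<le> card J - 1" if "n \<in> J" for c n
      using that by (metis (no_types, lifting) degree_smult_le le_trans)
    then have "degree q \<le> card J - 1"
      unfolding q_def using assms(1) by (intro degree_sum_le) simp_all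
    moreover have "card J > 0" using assms(3) by linarith
    ultimately show "card (x ` J) > degree q" using assms(2) by (simp add: card_image)
  qed
  then have "poly p w = poly q w" by simp
  then show ?thesis unfolding pq .
qed

text \<open>Interpolate the polynomial with roots \<open>u m\<close>, \<open>m \<noteq> k\<close>,
  at the nodes \<open>- v n\<close> and evaluate at \<open>u j\<close>: the value is 0 unless
  \<open>j = k\<close>. Dividing by the value at \<open>u k\<close> and rescaling by the products of
  the \<open>u + v\<close> turns the interpolation weights into the kernel
  \<open>1 / (u j + v n)\<close>.\<close>

lemma cauchy_matrix_inverse:
  fixes u v :: "'i \<Rightarrow> 'a :: field"
  assumes J: "finite J" "inj_on u J" "inj_on v J"
    and nz: "\<And>i j. i \<in> J \<Longrightarrow> j \<in> J \<Longrightarrow> u i + v j \<noteq> 0"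
    and jk: "j \<in> J" "k \<in> J"
  shows "(\<Sum>n\<in>J. (\<Prod>m\<in>J. u k + v m) * (\<Prod>m\<in>J - {k}. - v n - u m)
            / ((\<Prod>m\<in>J - {k}. u k - u m) * (\<Prod>m\<in>J - {n}. v m - v n)) / (u j + v n))
         = (if j = k then 1 else 0)"
proof -
  define p where "p = (\<Prod>m\<in>J - {k}. [:- u m, 1:])"
  have p: "poly p w = (\<Prod>m\<in>J - {k}. w - u m)" for w
    by (simp add: p_def poly_prod)
  have "degree p \<le> (\<Sum>m\<in>J - {k}. degree [:- u m, 1:])"
    using degree_prod_sum_le[of "J - {k}" "\<lambda>m. [:- u m, 1:]"] J(1) unfolding p_def by (simp add: o_def)
  then have "degree p \<le> card (J - {k})" by simp
  moreover have "card (J - {k}) < card J"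
    using J(1) jk by (meson card_Diff1_less)
  ultimately have deg: "degree p < card J" by linarith
  have inj: "inj_on (\<lambda>n. - v n) J" 
    by (rule inj_onI, rule inj_onD[OF J(3)]) simp_all
  have pk: "poly p (u k) \<noteq> 0"
  proof -
    have "u k - u m \<noteq> 0" if "m \<in> J - {k}" for m
      using that J(2) jk(2) by (auto simp: inj_on_eq_iff)
    then show ?thesis unfolding p by (subst prod_zero_iff) (use J(1) in auto)
  qed
  have pj: "poly p (u j) = (if j = k then poly p (u k) else 0)"
  proof (cases "j = k")
    case False
    then have "j \<in> J - {k}" using jk by auto
    then have "poly p (u j) = 0"
      unfolding p using J(1) by (intro prod_zero) auto
    then show ?thesis using False by simp
  qed simp
  have summand: "(\<Prod>m\<in>J. u k + v m) * (\<Prod>m\<in>J - {k}. - v n - u m)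
            / ((\<Prod>m\<in>J - {k}. u k - u m) * (\<Prod>m\<in>J - {n}. v m - v n)) / (u j + v n)
        = (\<Prod>m\<in>J. u k + v m) / (\<Prod>m\<in>J. u j + v m) / poly p (u k)
            * (poly p (- v n) * (\<Prod>m\<in>J - {n}. (u j - - v m) / (- v n - - v m)))"
    if n: "n \<in> J" for n
  proof -
    have split: "(\<Prod>m\<in>J. u j + v m) = (u j + v n) * (\<Prod>m\<in>J - {n}. u j + v m)"
      using J(1) n by (rule prod.remove)
    have quot: "(\<Prod>m\<in>J - {n}. (u j - - v m) / (- v n - - v m)) = (\<Prod>m\<in>J - {n}. u j + v m) / (\<Prod>m\<in>J - {n}. v m - v n)"
      by (simp add: prod_dividef)
    have alg: "A * B / (C * D) / x = A / (x * Q) / C * (B * (Q / D))" if "Q \<noteq> 0" for A B C D Q x :: 'a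
    proof -
      have "A / (x * Q) / C * (B * (Q / D)) = (A * B / (C * D) / x) * (Q / Q)" by simp
      then show ?thesis using that by simp
    qed
    have "(\<Prod>m\<in>J - {n}. u j + v m) \<noteq> 0"
      by (subst prod_zero_iff) (use J(1) nz[OF jk(1)] in auto)
    then show ?thesis
      unfolding p split quot by (rule alg)
  qed
  have "(\<Sum>n\<in>J. (\<Prod>m\<in>J. u k + v m) * (\<Prod>m\<in>J - {k}. - v n - u m)
            / ((\<Prod>m\<in>J - {k}. u k - u m) * (\<Prod>m\<in>J - {n}. v m - v n)) / (u j + v n))
       = (\<Prod>m\<in>J. u k + v m) / (\<Prod>m\<in>J. u j + v m) / poly p (u k) * poly p (u j)"
    by (subst lagrange_interpolation[OF J(1) inj deg, of "u j"], subst sum_distrib_left)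
      (rule sum.cong[OF refl summand])
  also have "\<dots> = (if j = k then 1 else 0)"
  proof (cases "j = k")
    case True
    have "(\<Prod>m\<in>J. u k + v m) \<noteq> 0"
      by (subst prod_zero_iff) (use J(1) nz[OF jk(2)] in auto)
    then show ?thesis unfolding True using pk by simp
  next
    case False
    then show ?thesis unfolding pj by simp
  qed
  finally show ?thesis .
qed

section \<open>Exponential estimates for quotients of cosh and sinh\<close>

lemma cosh_eq_exp_abs: "cosh (x::real) = exp \<bar>x\<bar> * (1 + exp (- 2 * \<bar>x\<bar>)) / 2"
proof -
  have "exp \<bar>x\<bar> * exp (- 2 * \<bar>x\<bar>) = exp (- \<bar>x\<bar>)"
    by (simp flip: exp_add)
  then show ?thesis
    by (cases "x \<ge> 0") (simp_all add: cosh_def distrib_left)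
qed

lemma abs_sinh_eq_exp_abs: "\<bar>sinh (x::real)\<bar> = exp \<bar>x\<bar> * (1 - exp (- 2 * \<bar>x\<bar>)) / 2"
proof -
  have *: "exp \<bar>x\<bar> * exp (- 2 * \<bar>x\<bar>) = exp (- \<bar>x\<bar>)"
    by (simp flip: exp_add)
  then show ?thesis
    by (cases "x \<ge> 0") (auto simp: sinh_def right_diff_distrib abs_if)
qed

text \<open>The quotient is \<open>1 + 2 * x / (1 - x)\<close>. An exponential bound with exponent
  linear in \<open>x\<close> lets a product over nodes be controlled by a geometric series in the
  exponent.\<close>

lemma one_plus_over_one_minus_le_exp:
  fixes x z :: real
  assumes "0 \<le> x" "x \<le> z" "z < 1"
  shows "(1 + x) / (1 - x) \<le> exp (2 * x / (1 - z))"
proof -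
  have "(1 + x) / (1 - x) = 1 + 2 * x / (1 - x)"
    using assms by (simp add: field_simps)
  also have "\<dots> \<le> 1 + 2 * x / (1 - z)"
    using assms by (intro add_left_mono divide_left_mono mult_pos_pos) auto
  also have "\<dots> \<le> exp (2 * x / (1 - z))"
    by (rule exp_ge_add_one_self)
  finally show ?thesis .
qed

text \<open>Up to the factors \<open>1 + exp (- 2 * \<bar>x\<bar>)\<close> and
  \<open>1 - exp (- 2 * \<bar>y\<bar>)\<close> both functions are half an exponential. The
  correction decays geometrically in \<open>j\<close>, which will be the index distance of two
  nodes.\<close>

lemma cosh_over_sinh_le:
  fixes x y s :: real
  assumes "0 < s" "j \<ge> 1" and x: "real j * s \<le> \<bar>x\<bar>" and y: "real j * s \<le> \<bar>y\<bar>"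
  shows "cosh x / \<bar>sinh y\<bar> \<le> exp (\<bar>x\<bar> - \<bar>y\<bar> + 2 * exp (- 2 * s) ^ j / (1 - exp (- 2 * s)))"
proof -
  define z where "z = exp (- 2 * s)"
  have z: "0 < z" "z < 1" using assms by (auto simp: z_def)
  have zj: "z ^ j \<le> z" "0 < z ^ j"
    using z power_decreasing[of 1 j z] assms(2) by auto
  then have zj1: "z ^ j < 1" using z by linarith
  have "exp (- 2 * \<bar>x\<bar>) \<le> z ^ j" "exp (- 2 * \<bar>y\<bar>) \<le> z ^ j"
    using x y unfolding z_def exp_of_nat_mult[symmetric] by (simp_all add: mult.left_commute)
  then have "cosh x \<le> exp \<bar>x\<bar> * (1 + z ^ j) / 2" "exp \<bar>y\<bar> * (1 - z ^ j) / 2 \<le> \<bar>sinh y\<bar>"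
    unfolding cosh_eq_exp_abs abs_sinh_eq_exp_abs by (simp_all only: divide_right_mono mult_left_mono add_left_mono diff_left_mono exp_ge_zero zero_le_numeral)
  then have "cosh x / \<bar>sinh y\<bar> \<le> (exp \<bar>x\<bar> * (1 + z ^ j) / 2) / (exp \<bar>y\<bar> * (1 - z ^ j) / 2)"
    using zj zj1 by (intro frac_le) auto
  also have "\<dots> = exp (\<bar>x\<bar> - \<bar>y\<bar>) * ((1 + z ^ j) / (1 - z ^ j))"
    by (simp add: exp_diff)
  also have "\<dots> \<le> exp (\<bar>x\<bar> - \<bar>y\<bar>) * exp (2 * z ^ j / (1 - z))"
    using zj z by (intro mult_left_mono one_plus_over_one_minus_le_exp) auto
  finally show ?thesis unfolding z_def exp_add[symmetric] .
qed

section \<open>Sech matrices on perturbed lattices\<close>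

lemma exp_add_eq_cosh: "exp (2 * x) + exp (2 * y) = 2 * exp (x + y) * cosh (x - y :: real)"
  by (simp add: cosh_def distrib_left flip: exp_add)

lemma exp_diff_eq_sinh: "exp (2 * x) - exp (2 * y) = 2 * exp (x + y) * sinh (x - y :: real)"
  by (simp add: sinh_def right_diff_distrib flip: exp_add)

text \<open>In the application \<open>q\<close> consists of the points \<open>t + k/b\<close> and
  \<open>p\<close> of the multiples of \<open>a\<close> nearest to them, both scaled by
  \<open>pi * \<gamma>\<close>; \<open>l\<close> is the lattice spacing and \<open>d\<close> bounds
  the displacement.\<close>

locale sech_nodes =
  fixes p q :: "int \<Rightarrow> real" and l d :: real
  assumes q_diff: "q m - q k = l * (of_int m - of_int k)"
    and pq: "\<bar>p m - q m\<bar> \<le> d"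
    and d2: "2 * d < l"
begin

abbreviation "s \<equiv> l - 2 * d"

lemma d_nonneg: "0 \<le> d" using pq[of 0] by linarith
lemma s_pos: "0 < s" using d2 by simp
lemma l_pos: "0 < l" using d2 d_nonneg by linarith

lemma q_diff_abs: "\<bar>q m - q k\<bar> = l * real (nat \<bar>m - k\<bar>)"
  using l_pos by (simp add: q_diff abs_mult flip: of_int_diff)

lemma q_less: "m < k \<Longrightarrow> q k - q m \<ge> l"
  using q_diff[of k m] l_pos mult_left_mono[of 1 "of_int k - of_int m" l] by auto

text \<open>With the two lemmas that follow: as displacements stay below half the spacing, nodes of
  different index keep their order, whichever of the two sequences each is taken from.\<close>

lemma p_less: "m < k \<Longrightarrow> p m < p k"
  using q_less[of m k] pq[of m] pq[of k] d2 by linarith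

lemma qp_less: "m < k \<Longrightarrow> q m < p k"
  using q_less[of m k] pq[of k] d2 d_nonneg by linarith

lemma pq_less: "m < k \<Longrightarrow> p m < q k"
  using q_less[of m k] pq[of m] d2 d_nonneg by linarith

text \<open>Displacements shorten a lattice gap by at most \<open>2 * d\<close>, hence by at most
  \<open>2 * d\<close> times the index distance, which is at least 1.\<close>

lemma s_le:
  assumes "m \<noteq> k"
  shows "real (nat \<bar>m - k\<bar>) * s \<le> \<bar>q m - q k\<bar>" "real (nat \<bar>m - k\<bar>) * s \<le> \<bar>p m - p k\<bar>"
    "real (nat \<bar>m - k\<bar>) * s \<le> \<bar>q m - p k\<bar>" "real (nat \<bar>m - k\<bar>) * s \<le> \<bar>p m - q k\<bar>"
proof -
  have "real (nat \<bar>m - k\<bar>) \<ge> 1" using assms by linarith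
  then have "2 * d \<le> real (nat \<bar>m - k\<bar>) * (2 * d)"
    using d_nonneg mult_right_mono[of 1 "real (nat \<bar>m - k\<bar>)" "2 * d"] by auto
  then have "real (nat \<bar>m - k\<bar>) * s \<le> \<bar>q m - q k\<bar> - 2 * d"
    unfolding q_diff_abs by (simp add: algebra_simps)
  moreover obtain x where x: "x = real (nat \<bar>m - k\<bar>) * s" by blast
  ultimately have *: "x \<le> \<bar>q m - q k\<bar> - 2 * d" by simp
  have h: "\<bar>q m - q k\<bar> \<le> \<bar>p m - p k\<bar> + 2 * d" "\<bar>q m - q k\<bar> \<le> \<bar>q m - p k\<bar> + d"
    "\<bar>q m - q k\<bar> \<le> \<bar>p m - q k\<bar> + d"
    using pq[of m] pq[of k] by linarith+
  have "x \<le> A" if "A0 \<le> A + 2 * d" "x \<le> A0 - 2 * d" for A A0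
    using that by linarith
  note A = this
  show "real (nat \<bar>m - k\<bar>) * s \<le> \<bar>q m - q k\<bar>"
    unfolding x[symmetric] by (rule A[OF _ *]) (simp add: d_nonneg)
  show "real (nat \<bar>m - k\<bar>) * s \<le> \<bar>p m - p k\<bar>"
    unfolding x[symmetric] by (rule A[OF h(1) *])
  show "real (nat \<bar>m - k\<bar>) * s \<le> \<bar>q m - p k\<bar>"
    unfolding x[symmetric] by (rule A[OF order_trans[OF h(2)] *]) (simp add: d_nonneg)
  show "real (nat \<bar>m - k\<bar>) * s \<le> \<bar>p m - q k\<bar>"
    unfolding x[symmetric] by (rule A[OF order_trans[OF h(3)] *]) (simp add: d_nonneg)
qed

definition u where "u m = exp (2 * q m)"
definition v where "v m = exp (2 * p m)"

text \<open>The entries of \<open>cauchy_matrix_inverse\<close>, rescaled by \<open>sqrt (u k) = exp (q k)\<close> and \<open>sqrt (v n) = exp (p n)\<close>.\<close>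

definition inv_entry :: "int set \<Rightarrow> int \<Rightarrow> int \<Rightarrow> real" where
  "inv_entry J k n = (\<Prod>m\<in>J. u k + v m) * (\<Prod>m\<in>J - {k}. - v n - u m)
            / ((\<Prod>m\<in>J - {k}. u k - u m) * (\<Prod>m\<in>J - {n}. v m - v n)) / (2 * exp (q k + p n))"

lemma uv_add: "u k + v m = 2 * exp (q k + p m) * cosh (q k - p m)"
  unfolding u_def v_def by (rule exp_add_eq_cosh)

lemma uu_diff: "\<bar>u k - u m\<bar> = 2 * exp (q k + q m) * \<bar>sinh (q k - q m)\<bar>"
  unfolding u_def exp_diff_eq_sinh by (simp add: abs_mult)

lemma vv_diff: "\<bar>v k - v m\<bar> = 2 * exp (p k + p m) * \<bar>sinh (p k - p m)\<bar>"
  unfolding v_def exp_diff_eq_sinh by (simp add: abs_mult)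

text \<open>By \<open>uv_add\<close> the rescaling converts \<open>1 / (u j + v n)\<close> into
  sech. What remains is the factor \<open>exp (q j - q k)\<close>, which is 1 for
  \<open>j = k\<close> and otherwise multiplies 0.\<close>

lemma inv_entry_inverse:
  assumes "finite J" "j \<in> J" "k \<in> J"
  shows "(\<Sum>n\<in>J. inv_entry J k n * (1 / cosh (q j - p n))) = (if j = k then 1 else 0)"
proof -
  have inj: "inj_on u J" "inj_on v J"
    using q_less p_less l_pos by (force simp: u_def v_def intro!: linorder_inj_onI')+
  have nz: "u i + v j \<noteq> 0" for i j unfolding u_def v_def by (smt (verit) exp_gt_zero)
  have "inv_entry J k n * (1 / cosh (q j - p n))
     = exp (q j - q k) * ((\<Prod>m\<in>J. u k + v m) * (\<Prod>m\<in>J - {k}. - v n - u m)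
            / ((\<Prod>m\<in>J - {k}. u k - u m) * (\<Prod>m\<in>J - {n}. v m - v n)) / (u j + v n))" for n
  proof -
    have "1 / (2 * exp (q k + p n)) * (1 / cosh (q j - p n)) = exp (q j - q k) / (u j + v n)"
      unfolding uv_add by (simp add: exp_add exp_diff)
    moreover have "A / E * (1 / c) = w * (A / x)" if "1 / E * (1 / c) = w / x" for A E c w x :: real
    proof -
      have "A / E * (1 / c) = A * (1 / E * (1 / c))" by simp
      also have "\<dots> = w * (A / x)" unfolding that by simp
      finally show ?thesis .
    qed
    ultimately show ?thesis
      unfolding inv_entry_def by blast
  qed
  then have "(\<Sum>n\<in>J. inv_entry J k n * (1 / cosh (q j - p n))) = exp (q j - q k) * (if j = k then 1 else 0)"
    using cauchy_matrix_inverse[OF assms(1) inj nz assms(2,3)]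
    by (simp only: sum_distrib_left[symmetric])
  then show ?thesis by simp
qed

abbreviation "z \<equiv> exp (- 2 * s)"

lemma z_bounds: "0 < z" "z < 1"
  using s_pos by auto

text \<open>Only nodes strictly between \<open>k\<close> and \<open>n\<close> contribute: for the others the four distances cancel.\<close>

lemma exponent_bound:
  assumes "m \<noteq> k" "m \<noteq> n"
  shows "\<bar>q k - p m\<bar> - \<bar>q k - q m\<bar> + (\<bar>q m - p n\<bar> - \<bar>p m - p n\<bar>)
      \<le> (if m \<in> {min k n<..<max k n} then 2 * d else 0)"
proof -
  consider "m < k" "m < n" | "k < m" "n < m" | "k < m" "m < n" | "n < m" "m < k"
    using assms by linarith
  then show ?thesis
  proof cases
    case 1
    then have "p m < q k" "q m + l \<le> q k" "q m < p n" "p m < p n"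
      using q_less[of m k] p_less[of m n] pq_less[of m k] qp_less[of m n] by auto
    then show ?thesis using 1 l_pos d_nonneg by (simp add: abs_if)
  next
    case 2
    then have "q k < p m" "q k + l \<le> q m" "p n < q m" "p n < p m"
      using q_less[of k m] p_less[of n m] pq_less[of n m] qp_less[of k m] by auto
    then show ?thesis using 2 l_pos d_nonneg by (simp add: abs_if)
  next
    \<comment> \<open>Here both differences equal \<open>p m - q m\<close>, so they add up instead
      of cancelling; in the mirrored case both equal \<open>q m - p m\<close>.\<close>
    case 3
    then have "q k < p m" "q k + l \<le> q m" "q m < p n" "p m < p n"
      using q_less[of k m] p_less[of m n] qp_less[of m n] qp_less[of k m] by auto
    then show ?thesis using 3 l_pos pq[of m] by (simp add: abs_if split: if_splits)
  next
    case 4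
    then have "p m < q k" "q m + l \<le> q k" "p n < q m" "p n < p m"
      using q_less[of m k] p_less[of n m] pq_less[of n m] pq_less[of m k] by auto
    then show ?thesis using 4 l_pos pq[of m] by (simp add: abs_if split: if_splits)
  qed
qed

text \<open>The part of \<open>\<bar>inv_entry J k n\<bar>\<close> that involves a third node
  \<open>m\<close>.\<close>

definition factor :: "int \<Rightarrow> int \<Rightarrow> int \<Rightarrow> real" where
  "factor k n m = (u k + v m) * (u m + v n) / (\<bar>u k - u m\<bar> * \<bar>v m - v n\<bar>)"

lemma factor_nonneg: "0 \<le> factor k n m"
  by (simp add: factor_def u_def v_def add_nonneg_nonneg)

lemma factor_bound:
  assumes "m \<noteq> k" "m \<noteq> n"
  shows "factor k n m \<le> exp ((if m \<in> {min k n<..<max k n} then 2 * d else 0)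
      + 2 / (1 - z) * (z ^ nat \<bar>m - k\<bar> + z ^ nat \<bar>m - n\<bar>))"
proof -
  \<comment> \<open>Numerator and denominator carry the same total exponent
    \<open>q k + q m + p m + p n\<close>, so the exponential prefactors cancel.\<close>
  have "factor k n m = (cosh (q k - p m) / \<bar>sinh (q k - q m)\<bar>) * (cosh (q m - p n) / \<bar>sinh (p m - p n)\<bar>)"
    unfolding factor_def uv_add uu_diff vv_diff by (simp add: exp_add)
  also have "\<dots> \<le> exp (\<bar>q k - p m\<bar> - \<bar>q k - q m\<bar> + 2 * z ^ nat \<bar>m - k\<bar> / (1 - z))
      * exp (\<bar>q m - p n\<bar> - \<bar>p m - p n\<bar> + 2 * z ^ nat \<bar>m - n\<bar> / (1 - z))"
  proof (rule mult_mono)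
    have j: "1 \<le> nat \<bar>m - k\<bar>" "1 \<le> nat \<bar>m - n\<bar>" using assms by auto
    show "cosh (q k - p m) / \<bar>sinh (q k - q m)\<bar> \<le> exp (\<bar>q k - p m\<bar> - \<bar>q k - q m\<bar> + 2 * z ^ nat \<bar>m - k\<bar> / (1 - z))"
      using s_le[of k m] assms by (intro cosh_over_sinh_le s_pos j) (simp_all add: abs_minus_commute[of k m])
    show "cosh (q m - p n) / \<bar>sinh (p m - p n)\<bar> \<le> exp (\<bar>q m - p n\<bar> - \<bar>p m - p n\<bar> + 2 * z ^ nat \<bar>m - n\<bar> / (1 - z))"
      using s_le[of m n] assms by (intro cosh_over_sinh_le s_pos j)
  qed (auto intro!: divide_nonneg_nonneg)
  also have "\<dots> = exp ((\<bar>q k - p m\<bar> - \<bar>q k - q m\<bar> + (\<bar>q m - p n\<bar> - \<bar>p m - p n\<bar>))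
      + 2 / (1 - z) * (z ^ nat \<bar>m - k\<bar> + z ^ nat \<bar>m - n\<bar>))"
    unfolding exp_add[symmetric] by (rule arg_cong[where f = exp]) (simp add: distrib_left)
  also have "\<dots> \<le> exp ((if m \<in> {min k n<..<max k n} then 2 * d else 0)
      + 2 / (1 - z) * (z ^ nat \<bar>m - k\<bar> + z ^ nat \<bar>m - n\<bar>))"
    unfolding exp_le_cancel_iff using exponent_bound[OF assms] by (rule add_right_mono)
  finally show ?thesis .
qed

text \<open>At most \<open>\<bar>k - n\<bar>\<close> nodes lie strictly between \<open>k\<close> and
  \<open>n\<close>, each costing \<open>2 * d\<close> in the exponent. The corrections form two
  geometric sums of size at most \<open>2 / (1 - z)\<close>, whence the 8.\<close>

lemma prod_factor_bound:
  assumes "finite J"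
  shows "(\<Prod>m\<in>J - {k, n}. factor k n m) \<le> exp (2 * d * real (nat \<bar>k - n\<bar>) + 8 / (1 - z)\<^sup>2)"
proof -
  let ?I = "{min k n<..<max k n}"
  have "(\<Prod>m\<in>J - {k, n}. factor k n m)
      \<le> (\<Prod>m\<in>J - {k, n}. exp ((if m \<in> ?I then 2 * d else 0)
          + 2 / (1 - z) * (z ^ nat \<bar>m - k\<bar> + z ^ nat \<bar>m - n\<bar>)))"
    by (intro prod_mono conjI factor_nonneg factor_bound) auto
  also have "\<dots> = exp ((\<Sum>m\<in>J - {k, n}. if m \<in> ?I then 2 * d else 0)
      + 2 / (1 - z) * ((\<Sum>m\<in>J - {k, n}. z ^ nat \<bar>m - k\<bar>) + (\<Sum>m\<in>J - {k, n}. z ^ nat \<bar>m - n\<bar>)))"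
    using assms by (simp only: exp_sum[symmetric] finite_Diff sum.distrib sum_distrib_left[symmetric])
  also have "\<dots> \<le> exp (2 * d * real (nat \<bar>k - n\<bar>) + 2 / (1 - z) * (2 / (1 - z) + 2 / (1 - z)))"
    unfolding exp_le_cancel_iff
  proof (intro add_mono mult_left_mono)
    have "(\<Sum>m\<in>J - {k, n}. if m \<in> ?I then 2 * d else 0) = (\<Sum>m\<in>(J - {k, n}) \<inter> ?I. 2 * d)"
      by (rule sum.inter_restrict[symmetric]) (use assms in simp)
    also have "\<dots> \<le> (\<Sum>m\<in>?I. 2 * d)"
      by (rule sum_mono2) (use d_nonneg in auto)
    also have "\<dots> \<le> real (nat \<bar>k - n\<bar>) * (2 * d)"
      unfolding sum_constant by (intro mult_right_mono) (use d_nonneg in \<open>auto simp: min_def max_def\<close>)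
    finally show "(\<Sum>m\<in>J - {k, n}. if m \<in> ?I then 2 * d else 0) \<le> 2 * d * real (nat \<bar>k - n\<bar>)"
      by (simp only: mult.commute)
    show "(\<Sum>m\<in>J - {k, n}. z ^ nat \<bar>m - k\<bar>) \<le> 2 / (1 - z)" "(\<Sum>m\<in>J - {k, n}. z ^ nat \<bar>m - n\<bar>) \<le> 2 / (1 - z)"
      using z_bounds assms by (intro sum_power_abs_diff_le; simp)+
    show "0 \<le> 2 / (1 - z)" using z_bounds by simp
  qed
  also have "2 / (1 - z) * (2 / (1 - z) + 2 / (1 - z)) = 8 / (1 - z)\<^sup>2"
    by (simp add: power2_eq_square)
  finally show ?thesis .
qed

text \<open>The first exponential collects the third nodes, \<open>(cosh d)\<^sup>2\<close> the
  factors \<open>u k + v k\<close> and \<open>u n + v n\<close>, and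
  \<open>4 * exp d / (1 - z)\<^sup>2\<close> the interaction of \<open>k\<close> with
  \<open>n\<close>.\<close>

definition inv_const :: real where
  "inv_const = exp (8 / (1 - z)\<^sup>2) * (cosh d)\<^sup>2 * 4 * exp d / (1 - z)\<^sup>2"

lemma cosh_pq: "cosh (q k - p k) \<le> cosh d"
proof -
  have "cosh \<bar>q k - p k\<bar> \<le> cosh d"
    using pq[of k] by (subst cosh_real_nonneg_le_iff) (auto simp: abs_minus_commute d_nonneg)
  then show ?thesis by simp
qed

lemma sinh_lower:
  assumes "s \<le> \<bar>x\<bar>"
  shows "exp \<bar>x\<bar> * (1 - z) / 2 \<le> \<bar>sinh x\<bar>"
  unfolding abs_sinh_eq_exp_abs using assms by (intro divide_right_mono mult_left_mono diff_left_mono) auto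

text \<open>The numerator is at most \<open>exp (\<bar>p k - p n\<bar> + d)\<close>, which the
  growth of the first sinh absorbs. The second sinh grows like the exponential of the lattice
  distance and leaves the decay.\<close>

lemma pair_bound:
  assumes "k \<noteq> n"
  shows "cosh (q k - p n) / (\<bar>sinh (p k - p n)\<bar> * \<bar>sinh (q k - q n)\<bar>)
     \<le> 4 * exp d / (1 - z)\<^sup>2 * exp (- l * real (nat \<bar>k - n\<bar>))"
proof -
  have j: "s \<le> real (nat \<bar>k - n\<bar>) * s"
    using assms s_pos mult_right_mono[of 1 "real (nat \<bar>k - n\<bar>)" s] by auto
  note b = s_le[OF assms, THEN order_trans[OF j]]
  have "cosh (q k - p n) \<le> exp \<bar>q k - p n\<bar>"
    by (cases "q k - p n \<ge> 0") (auto simp: cosh_def)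
  also have "\<dots> \<le> exp (\<bar>p k - p n\<bar> + d)"
    unfolding exp_le_cancel_iff using pq[of k] by linarith
  finally have "cosh (q k - p n) / (\<bar>sinh (p k - p n)\<bar> * \<bar>sinh (q k - q n)\<bar>)
      \<le> exp (\<bar>p k - p n\<bar> + d) / ((exp \<bar>p k - p n\<bar> * (1 - z) / 2) * (exp \<bar>q k - q n\<bar> * (1 - z) / 2))"
    using z_bounds by (intro frac_le mult_mono sinh_lower b mult_pos_pos divide_pos_pos) auto
  also have "\<dots> = 4 * exp d / (1 - z)\<^sup>2 * exp (- l * real (nat \<bar>k - n\<bar>))"
  proof -
    have "x * e / (x * w / 2 * (y * w / 2)) = 4 * e / w\<^sup>2 * inverse y" if "x \<noteq> 0" for x y e w :: real
      using that by (simp add: power2_eq_square divide_simps)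
    then show ?thesis
      unfolding q_diff_abs exp_add minus_mult_left[symmetric] exp_minus by (metis exp_not_eq_zero)
  qed
  finally show ?thesis .
qed

lemma abs_inv_entry:
  "\<bar>inv_entry J k n\<bar> = (\<Prod>m\<in>J. u k + v m) * (\<Prod>m\<in>J - {k}. u m + v n)
            / ((\<Prod>m\<in>J - {k}. \<bar>u k - u m\<bar>) * (\<Prod>m\<in>J - {n}. \<bar>v m - v n\<bar>)) / (2 * exp (q k + p n))"
proof -
  have "\<bar>- v n - u m\<bar> = u m + v n" "\<bar>u k + v m\<bar> = u k + v m" for m
    using exp_gt_zero[of "2 * q m"] exp_gt_zero[of "2 * p n"] exp_gt_zero[of "2 * q k"] exp_gt_zero[of "2 * p m"]
    unfolding u_def v_def by linarith+
  then show ?thesis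
    unfolding inv_entry_def abs_divide abs_mult abs_prod by simp
qed

text \<open>Decay at rate \<open>l\<close> from the pair \<open>k\<close>, \<open>n\<close> competes
  with growth at rate at most \<open>2 * d\<close> from the nodes in between; the net rate is
  \<open>s > 0\<close>.\<close>

lemma inv_entry_bound:
  assumes J: "finite J" "k \<in> J" "n \<in> J"
  shows "\<bar>inv_entry J k n\<bar> \<le> inv_const * exp (- s) ^ nat \<bar>k - n\<bar>"
proof (cases "k = n")
  case True
  \<comment> \<open>\<open>J - {k, k}\<close> is written to match \<open>prod_factor_bound\<close>
    at \<open>n = k\<close>.\<close>
  have "\<bar>inv_entry J k k\<bar> = (u k + v k) / (2 * exp (q k + p k)) * (\<Prod>m\<in>J - {k, k}. factor k k m)"
    unfolding abs_inv_entry factor_def prod_dividef prod.distrib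
    by (simp add: prod.remove[OF J(1,2)] mult.commute mult.left_commute)
  also have "\<dots> = cosh (q k - p k) * (\<Prod>m\<in>J - {k, k}. factor k k m)"
    unfolding uv_add by simp
  also have "\<dots> \<le> cosh d * exp (2 * d * real (nat \<bar>k - k\<bar>) + 8 / (1 - z)\<^sup>2)"
    by (intro mult_mono cosh_pq prod_factor_bound J(1) prod_nonneg factor_nonneg) auto
  \<comment> \<open>Compared with \<open>inv_const\<close>, the diagonal lacks one
    \<open>cosh d\<close> and the interaction constant; both are at least 1.\<close>
  also have "\<dots> \<le> inv_const"
  proof -
    have "cosh d * 1 \<le> (cosh d)\<^sup>2" using cosh_real_ge_1[of d] unfolding power2_eq_square by (intro mult_left_mono) auto
    moreover have "1 \<le> 4 * exp d / (1 - z)\<^sup>2"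
    proof -
      have "(1 - z)\<^sup>2 \<le> 1" using z_bounds by (intro power_le_one) auto
      moreover have "1 \<le> exp d" using d_nonneg by simp
      moreover have "(1 - z)\<^sup>2 > 0" using z_bounds by simp
      ultimately show ?thesis by (simp only: le_divide_eq_1_pos)
    qed
    ultimately have "exp (8 / (1 - z)\<^sup>2) * cosh d * 1 \<le> exp (8 / (1 - z)\<^sup>2) * (cosh d)\<^sup>2 * (4 * exp d / (1 - z)\<^sup>2)"
      by (intro mult_mono) auto
    also have "exp (8 / (1 - z)\<^sup>2) * (cosh d)\<^sup>2 * (4 * exp d / (1 - z)\<^sup>2) = inv_const"
      by (simp add: inv_const_def)
    finally show ?thesis by (simp add: mult.commute)
  qed
  finally show ?thesis using True by simp
next
  case False
  have J1: "finite (J - {k})" "n \<in> J - {k}" and J2: "finite (J - {n})" "k \<in> J - {n}" using J False by auto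
  have sets: "J - {k} - {n} = J - {k, n}" "J - {n} - {k} = J - {k, n}" by auto
  let ?P = "\<Prod>m\<in>J - {k, n}. factor k n m"
  have "\<bar>inv_entry J k n\<bar> = ((u k + v k) * (u k + v n) * (u n + v n) / (\<bar>u k - u n\<bar> * \<bar>v k - v n\<bar>) / (2 * exp (q k + p n))) * ?P"
    unfolding abs_inv_entry factor_def prod_dividef prod.distrib
      prod.remove[OF J(1,2), of "\<lambda>m. u k + v m"] prod.remove[OF J1] prod.remove[OF J2] sets
    by (simp add: mult.assoc mult.commute mult.left_commute)
  also have "\<dots> = (cosh (q k - p k) * cosh (q n - p n) * (cosh (q k - p n) / (\<bar>sinh (p k - p n)\<bar> * \<bar>sinh (q k - q n)\<bar>))) * ?P"
    unfolding uv_add uu_diff vv_diff by (simp add: exp_add)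
  also have "\<dots> \<le> (cosh d * cosh d * (4 * exp d / (1 - z)\<^sup>2 * exp (- l * real (nat \<bar>k - n\<bar>))))
      * exp (2 * d * real (nat \<bar>k - n\<bar>) + 8 / (1 - z)\<^sup>2)"
    by (intro mult_mono cosh_pq prod_factor_bound pair_bound J(1) False prod_nonneg factor_nonneg
        mult_nonneg_nonneg divide_nonneg_nonneg) simp_all
  also have "\<dots> = inv_const * (exp (- l * real (nat \<bar>k - n\<bar>)) * exp (2 * d * real (nat \<bar>k - n\<bar>)))"
    unfolding inv_const_def exp_add by (simp add: power2_eq_square mult.commute mult.left_commute)
  also have "exp (- l * real (nat \<bar>k - n\<bar>)) * exp (2 * d * real (nat \<bar>k - n\<bar>)) = exp (- s) ^ nat \<bar>k - n\<bar>"
    unfolding exp_add[symmetric] exp_of_nat_mult[symmetric] by (rule arg_cong[where f = exp]) (simp add: algebra_simps)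
  finally show ?thesis .
qed

text \<open>The inverse recovers \<open>c\<close> from the output \<open>w\<close>, and the
  geometric decay of its entries gives row and column sums the same bound in Schur's test. The
  constant depends only on \<open>l\<close> and \<open>d\<close>, not on \<open>J\<close> or the
  position of the nodes.\<close>

lemma sech_matrix_lower_bound:
  fixes c :: "int \<Rightarrow> complex"
  assumes J: "finite J"
  shows "(\<Sum>k\<in>J. (cmod (c k))\<^sup>2)
    \<le> (2 * inv_const / (1 - exp (- s)))\<^sup>2 * (\<Sum>n\<in>J. (cmod (\<Sum>k\<in>J. of_real (1 / cosh (q k - p n)) * c k))\<^sup>2)"
proof -
  define w where "w n = (\<Sum>k\<in>J. of_real (1 / cosh (q k - p n)) * c k)" for n
  have inv_const: "0 \<le> inv_const" unfolding inv_const_def by (simp add: zero_le_divide_iff)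
  have r: "0 \<le> exp (- s)" "exp (- s) < 1" using s_pos by auto
  have c: "c j = (\<Sum>n\<in>J. of_real (inv_entry J j n) * w n)" if j: "j \<in> J" for j
  proof -
    have "(\<Sum>n\<in>J. of_real (inv_entry J j n) * w n)
        = (\<Sum>k\<in>J. of_real (\<Sum>n\<in>J. inv_entry J j n * (1 / cosh (q k - p n))) * c k)"
      unfolding w_def of_real_sum sum_distrib_left sum_distrib_right
      by (subst sum.swap) (simp add: mult.assoc)
    also have "\<dots> = (\<Sum>k\<in>J. if k = j then c k else 0)"
      using inv_entry_inverse[OF J _ j] by (intro sum.cong) auto
    finally show ?thesis using j J by simp
  qed
  have row: "(\<Sum>n\<in>J. \<bar>inv_entry J k n\<bar>) \<le> 2 * inv_const / (1 - exp (- s))" if "k \<in> J" for k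
  proof -
    have "(\<Sum>n\<in>J. \<bar>inv_entry J k n\<bar>) \<le> (\<Sum>n\<in>J. inv_const * exp (- s) ^ nat \<bar>n - k\<bar>)"
      using inv_entry_bound[OF J that] by (intro sum_mono) (simp add: abs_minus_commute)
    also have "\<dots> \<le> inv_const * (2 / (1 - exp (- s)))"
      unfolding sum_distrib_left[symmetric] using inv_const by (intro mult_left_mono sum_power_abs_diff_le r J)
    finally show ?thesis by (simp add: mult.commute)
  qed
  have col: "(\<Sum>k\<in>J. \<bar>inv_entry J k n\<bar>) \<le> 2 * inv_const / (1 - exp (- s))" if "n \<in> J" for n
  proof -
    have "(\<Sum>k\<in>J. \<bar>inv_entry J k n\<bar>) \<le> (\<Sum>k\<in>J. inv_const * exp (- s) ^ nat \<bar>k - n\<bar>)"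
      using inv_entry_bound[OF J _ that] by (intro sum_mono) auto
    also have "\<dots> \<le> inv_const * (2 / (1 - exp (- s)))"
      unfolding sum_distrib_left[symmetric] using inv_const by (intro mult_left_mono sum_power_abs_diff_le r J)
    finally show ?thesis by (simp add: mult.commute)
  qed
  have "(\<Sum>k\<in>J. (cmod (c k))\<^sup>2) = (\<Sum>k\<in>J. (cmod (\<Sum>n\<in>J. of_real (inv_entry J k n) * w n))\<^sup>2)"
    using c by (intro sum.cong) auto
  also have "\<dots> \<le> (2 * inv_const / (1 - exp (- s))) * (2 * inv_const / (1 - exp (- s))) * (\<Sum>n\<in>J. (cmod (w n))\<^sup>2)"
    using inv_const r by (intro schur_test row col) auto
  finally show ?thesis by (simp only: w_def power2_eq_square)
qed

end

section \<open>Trigonometric polynomials\<close>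

text \<open>Finite combinations of the characters of period \<open>1/b\<close>. The inductive form
  suits closure proofs; \<open>trig_poly_expansion\<close> supplies the coefficients.\<close>

inductive trig_poly :: "real \<Rightarrow> (real \<Rightarrow> complex) \<Rightarrow> bool" for b where
  monomial: "trig_poly b (\<lambda>t. \<alpha> * cis (2 * pi * b * of_int m * t))"
| add: "trig_poly b p \<Longrightarrow> trig_poly b q \<Longrightarrow> trig_poly b (\<lambda>t. p t + q t)"

lemma trig_poly_const: "trig_poly b (\<lambda>t. \<alpha>)"
  using trig_poly.monomial[of b \<alpha> 0] by simp

lemma trig_poly_mult:
  assumes "trig_poly b p" "trig_poly b q"
  shows "trig_poly b (\<lambda>t. p t * q t)"
  using assms
proof (induction p rule: trig_poly.induct)
  case (monomial \<alpha> m)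
  from monomial show ?case
  proof (induction q rule: trig_poly.induct)
    case (monomial \<beta> n)
    have "(\<lambda>t. \<alpha> * cis (2 * pi * b * of_int m * t) * (\<beta> * cis (2 * pi * b * of_int n * t)))
        = (\<lambda>t. (\<alpha> * \<beta>) * cis (2 * pi * b * of_int (m + n) * t))"
      by (simp add: fun_eq_iff algebra_simps flip: cis_mult)
    then show ?case using trig_poly.monomial by metis
  next
    case (add p q)
    then show ?case using trig_poly.add by (simp add: distrib_left)
  qed
next
  case (add p q)
  then show ?case using trig_poly.add by (simp add: distrib_right)
qed

lemma trig_poly_expansion:
  assumes "trig_poly b p"
  shows "\<exists>F \<alpha>. finite F \<and> p = (\<lambda>t. \<Sum>m\<in>F. \<alpha> m * cis (2 * pi * b * of_int m * t))"
  using assms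
proof induction
  case (monomial \<alpha> m)
  show ?case by (rule exI[of _ "{m}"], rule exI[of _ "\<lambda>_. \<alpha>"]) simp
next
  case (add p q)
  then obtain F \<alpha> G \<beta> where
    F: "finite F" "p = (\<lambda>t. \<Sum>m\<in>F. \<alpha> m * cis (2 * pi * b * of_int m * t))" and
    G: "finite G" "q = (\<lambda>t. \<Sum>m\<in>G. \<beta> m * cis (2 * pi * b * of_int m * t))" by blast
  \<comment> \<open>Both coefficient families are extended by 0, so that a frequency common to
    \<open>F\<close> and \<open>G\<close> receives the sum.\<close>
  let ?c = "\<lambda>m. (if m \<in> F then \<alpha> m else 0) + (if m \<in> G then \<beta> m else 0)"
  have "p t + q t = (\<Sum>m\<in>F \<union> G. ?c m * cis (2 * pi * b * of_int m * t))" for t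
  proof -
    have "(\<Sum>m\<in>F. \<alpha> m * cis (2 * pi * b * of_int m * t))
        = (\<Sum>m\<in>F \<union> G. (if m \<in> F then \<alpha> m else 0) * cis (2 * pi * b * of_int m * t))"
      using F(1) G(1) by (intro sum.mono_neutral_cong_left) auto
    moreover have "(\<Sum>m\<in>G. \<beta> m * cis (2 * pi * b * of_int m * t))
        = (\<Sum>m\<in>F \<union> G. (if m \<in> G then \<beta> m else 0) * cis (2 * pi * b * of_int m * t))"
      using F(1) G(1) by (intro sum.mono_neutral_cong_left) auto
    ultimately show ?thesis
      unfolding F(2) G(2) by (simp only: sum.distrib[symmetric] distrib_right)
  qed
  then have "(\<lambda>t. p t + q t) = (\<lambda>t. \<Sum>m\<in>F \<union> G. ?c m * cis (2 * pi * b * of_int m * t))" by (rule ext)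
  moreover have "finite (F \<union> G)" using F(1) G(1) by simp
  ultimately show ?case by (intro exI conjI)
qed

text \<open>A real-linear functional restricted to the circle is a combination of cosine and sine,
  hence of \<open>cis\<close> at the frequencies 1 and -1; sums and products follow by
  closure.\<close>

lemma trig_poly_real_polynomial:
  assumes "real_polynomial_function (r :: complex \<Rightarrow> real)"
  shows "trig_poly b (\<lambda>t. of_real (r (cis (2 * pi * b * t))))"
  using assms
proof induction
  case (linear f)
  interpret bounded_linear f by fact
  have "of_real (f (cis (2 * pi * b * t)))
     = ((of_real (f 1) - \<i> * of_real (f \<i>)) / 2) * cis (2 * pi * b * of_int 1 * t)
     + ((of_real (f 1) + \<i> * of_real (f \<i>)) / 2) * cis (2 * pi * b * of_int (- 1) * t)" (is "_ = ?r t") for t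
  proof -
    have "cis (2 * pi * b * t) = cos (2 * pi * b * t) *\<^sub>R 1 + sin (2 * pi * b * t) *\<^sub>R \<i>"
      by (simp add: complex_eq_iff)
    then have "f (cis (2 * pi * b * t)) = cos (2 * pi * b * t) * f 1 + sin (2 * pi * b * t) * f \<i>"
      by (simp only: add scale real_scaleR_def)
    then show ?thesis by (simp add: complex_eq_iff field_simps)
  qed
  then have "(\<lambda>t. of_real (f (cis (2 * pi * b * t)))) = ?r" by (rule ext)
  moreover have "trig_poly b ?r" by (intro trig_poly.intros)
  ultimately show ?case by simp
next
  case (const c)
  show ?case by (rule trig_poly_const)
next
  case (add f g)
  then show ?case using trig_poly.add by simp
next
  case (mult f g)
  then show ?case using trig_poly_mult by simp
qed

lemma trig_poly_polynomial:
  assumes "polynomial_function (g :: complex \<Rightarrow> complex)"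
  shows "trig_poly b (\<lambda>t. g (cis (2 * pi * b * t)))"
proof -
  have "real_polynomial_function (Re \<circ> g)" "real_polynomial_function (Im \<circ> g)"
    using assms bounded_linear_Re bounded_linear_Im by (auto simp: polynomial_function_def)
  then have "trig_poly b (\<lambda>t. of_real ((Re \<circ> g) (cis (2 * pi * b * t))) + \<i> * of_real ((Im \<circ> g) (cis (2 * pi * b * t))))"
    by (intro trig_poly.add trig_poly_mult trig_poly_const trig_poly_real_polynomial)
  then show ?thesis by (simp flip: complex_eq)
qed

text \<open>Equal end values make \<open>h\<close> a continuous function on the circle.
  Stone-Weierstrass approximates it there by a polynomial, whose restriction to the circle is
  trigonometric.\<close>

lemma trig_poly_uniform_approx:
  fixes h :: "real \<Rightarrow> complex"
  assumes b: "0 < b" and h: "continuous_on {0..1/b} h" "h 0 = h (1/b)" and e: "0 < e"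
  obtains p where "trig_poly b p" "\<And>t. t \<in> {0..<1/b} \<Longrightarrow> cmod (h t - p t) < e"
proof -
  define c where "c t = h (t / b)" for t
  have "continuous_on {0..1} c"
    unfolding c_def using b
    by (intro continuous_on_compose2[OF h(1)] continuous_intros) (auto simp: divide_simps)
  \<comment> \<open>The loop is homotopic to itself; the associated circle map is thereby
    continuous, also at the point 1, where \<open>Arg2pi\<close> jumps.\<close>
  then have "homotopic_loops UNIV c c"
    using h(2) by (simp add: homotopic_loops_refl path_def pathfinish_def pathstart_def c_def)
  from homotopic_with_imp_continuous[OF homotopic_loops_imp_homotopic_circlemaps[OF this]]
  have cont: "continuous_on (sphere 0 1) (c \<circ> (\<lambda>z. Arg2pi z / (2 * pi)))" by simp
  obtain g where g: "polynomial_function g"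
      "\<And>z. z \<in> sphere 0 1 \<Longrightarrow> cmod ((c \<circ> (\<lambda>z. Arg2pi z / (2 * pi))) z - g z) < e"
    using Stone_Weierstrass_polynomial_function[OF compact_sphere cont e] by metis
  show ?thesis
  proof
    show "trig_poly b (\<lambda>t. g (cis (2 * pi * b * t)))" by (rule trig_poly_polynomial[OF g(1)])
    fix t assume t: "t \<in> {0..<1/b}"
    \<comment> \<open>Leaving out the right end of the period keeps the angle below
      \<open>2 * pi\<close>, where \<open>Arg2pi\<close> inverts \<open>cis\<close>.\<close>
    have "Arg2pi (cis (2 * pi * b * t)) = 2 * pi * b * t"
    proof (rule Arg2pi_unique[of 1])
      have "b * t < 1" using t b by (simp add: field_simps)
      then show "2 * pi * b * t < 2 * pi" by (simp add: mult.assoc)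
    qed (use t b in \<open>auto simp: cis_conv_exp\<close>)
    then have "(c \<circ> (\<lambda>z. Arg2pi z / (2 * pi))) (cis (2 * pi * b * t)) = h t"
      using b by (simp add: c_def)
    then show "cmod (h t - g (cis (2 * pi * b * t))) < e"
      using g(2)[of "cis (2 * pi * b * t)"] by simp
  qed
qed

lemma trig_poly_continuous: "trig_poly b p \<Longrightarrow> continuous_on S p"
  by (induction rule: trig_poly.induct) (auto intro!: continuous_intros)

lemma trig_poly_bounded: "trig_poly b p \<Longrightarrow> \<exists>B. \<forall>t. cmod (p t) \<le> B"
proof (induction rule: trig_poly.induct)
  case (monomial \<alpha> m)
  show ?case by (rule exI[of _ "cmod \<alpha>"]) (simp add: norm_mult)
next
  case (add p q)
  then obtain B C where "\<forall>t. cmod (p t) \<le> B" "\<forall>t. cmod (q t) \<le> C" by blast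
  then have "\<forall>t. cmod (p t + q t) \<le> B + C" by (meson add_mono norm_triangle_ineq order_trans)
  then show ?case by blast
qed

section \<open>Density and Parseval's identity on one period\<close>

abbreviation period_measure :: "real \<Rightarrow> real measure" where
  "period_measure b \<equiv> restrict_space lborel {0..<1/b}"

lemma finite_measure_period: "0 < b \<Longrightarrow> finite_measure (period_measure b)"
  by (rule finite_measureI) (simp add: emeasure_restrict_space space_restrict_space)

lemma measure_period: "0 < b \<Longrightarrow> measure (period_measure b) (space (period_measure b)) = 1 / b"
  by (simp add: measure_restrict_space space_restrict_space)

lemma measurable_period: "f \<in> borel_measurable borel \<Longrightarrow> f \<in> borel_measurable (period_measure b)"
  by (intro measurable_restrict_space1) simp

lemma norm_add_power2_le: "(norm (x + y))\<^sup>2 \<le> 2 * (norm x)\<^sup>2 + 2 * (norm (y::'a::real_normed_vector))\<^sup>2"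
proof -
  have "(norm (x + y))\<^sup>2 \<le> (norm x + norm y)\<^sup>2"
    by (intro power_mono norm_triangle_ineq) auto
  also have "\<dots> \<le> 2 * (norm x)\<^sup>2 + 2 * (norm y)\<^sup>2"
    using sum_squares_bound[of "norm x" "norm y"] by (simp add: power2_sum)
  finally show ?thesis .
qed

text \<open>The Bochner integral is 0 for a non-integrable integrand, so the notion is meaningful
  for functions that are square integrable over the period.\<close>

definition L2_approximable :: "real \<Rightarrow> (real \<Rightarrow> complex) \<Rightarrow> bool" where
  "L2_approximable b \<Phi> \<longleftrightarrow>
    (\<forall>e>0. \<exists>p. trig_poly b p \<and> (\<integral>t. (cmod (\<Phi> t - p t))\<^sup>2 \<partial>period_measure b) \<le> e)"

text \<open>Dominated convergence brings \<open>\<Psi> n\<close> close to \<open>\<Phi>\<close> in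
  mean square; a trigonometric polynomial near one such \<open>\<Psi> n\<close> is then near
  \<open>\<Phi>\<close>.\<close>

lemma L2_approximable_limit:
  fixes \<Phi> :: "real \<Rightarrow> complex" and \<Psi> :: "nat \<Rightarrow> real \<Rightarrow> complex"
  assumes b: "0 < b"
    and meas: "\<Phi> \<in> borel_measurable borel" "\<And>n. \<Psi> n \<in> borel_measurable borel"
    and lim: "AE t in period_measure b. (\<lambda>n. \<Psi> n t) \<longlonglongrightarrow> \<Phi> t"
    and bound: "\<And>t. t \<in> {0..<1/b} \<Longrightarrow> cmod (\<Phi> t) \<le> G t" "\<And>n t. t \<in> {0..<1/b} \<Longrightarrow> cmod (\<Psi> n t) \<le> G t"
    and G: "integrable (period_measure b) (\<lambda>t. (G t)\<^sup>2)"
    and approx: "\<And>n. L2_approximable b (\<Psi> n)"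
  shows "L2_approximable b \<Phi>"
proof -
  interpret finite_measure "period_measure b" by (rule finite_measure_period[OF b])
  note [measurable] = meas[THEN measurable_period[of _ b]]
  have "(\<lambda>n. \<integral>t. (cmod (\<Psi> n t - \<Phi> t))\<^sup>2 \<partial>period_measure b) \<longlonglongrightarrow> (\<integral>t. 0 \<partial>period_measure b)"
  proof (rule integral_dominated_convergence[where w = "\<lambda>t. 4 * (G t)\<^sup>2"])
    show "AE t in period_measure b. (\<lambda>n. (cmod (\<Psi> n t - \<Phi> t))\<^sup>2) \<longlonglongrightarrow> 0"
      using lim
    proof eventually_elim
      case (elim t)
      then have "(\<lambda>n. (cmod (\<Psi> n t - \<Phi> t))\<^sup>2) \<longlonglongrightarrow> (cmod (\<Phi> t - \<Phi> t))\<^sup>2"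
        by (intro tendsto_intros)
      then show ?case by simp
    qed
    show "AE t in period_measure b. norm ((cmod (\<Psi> n t - \<Phi> t))\<^sup>2) \<le> 4 * (G t)\<^sup>2" for n
    proof (rule AE_I2)
      fix t assume "t \<in> space (period_measure b)"
      then have t: "t \<in> {0..<1/b}" by (simp add: space_restrict_space)
      have "(cmod (\<Psi> n t - \<Phi> t))\<^sup>2 \<le> 2 * (cmod (\<Psi> n t))\<^sup>2 + 2 * (cmod (- \<Phi> t))\<^sup>2"
        using norm_add_power2_le[of "\<Psi> n t" "- \<Phi> t"] by simp
      also have "\<dots> \<le> 2 * (G t)\<^sup>2 + 2 * (G t)\<^sup>2"
        using bound(1)[OF t] bound(2)[OF t, of n] by (intro add_mono mult_left_mono power_mono) auto
      finally show "norm ((cmod (\<Psi> n t - \<Phi> t))\<^sup>2) \<le> 4 * (G t)\<^sup>2" by simp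
    qed
  qed (use G in auto)
  then have lim0: "(\<lambda>n. \<integral>t. (cmod (\<Psi> n t - \<Phi> t))\<^sup>2 \<partial>period_measure b) \<longlonglongrightarrow> 0" by simp
  have int_bound: "integrable (period_measure b) (\<lambda>t. (cmod (h t))\<^sup>2)"
    if [measurable]: "h \<in> borel_measurable (period_measure b)"
      and h: "\<And>t. t \<in> {0..<1/b} \<Longrightarrow> cmod (h t) \<le> G t + C" for h :: "real \<Rightarrow> complex" and C
  proof (rule Bochner_Integration.integrable_bound)
    show "integrable (period_measure b) (\<lambda>t. 2 * (G t)\<^sup>2 + 2 * C\<^sup>2)" using G by simp
    have "(cmod (h t))\<^sup>2 \<le> 2 * (G t)\<^sup>2 + 2 * C\<^sup>2" if "t \<in> {0..<1/b}" for t
    proof -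
      have "(cmod (h t))\<^sup>2 \<le> (G t + C)\<^sup>2" using h[OF that] by (intro power_mono) auto
      also have "\<dots> \<le> 2 * (G t)\<^sup>2 + 2 * C\<^sup>2" using sum_squares_bound[of "G t" C] by (simp add: power2_sum)
      finally show ?thesis .
    qed
    then show "AE t in period_measure b. norm ((cmod (h t))\<^sup>2) \<le> norm (2 * (G t)\<^sup>2 + 2 * C\<^sup>2)"
      by (intro AE_I2) (auto simp: space_restrict_space)
  qed simp
  show ?thesis
    unfolding L2_approximable_def
  proof (intro allI impI)
    fix e :: real assume e: "0 < e"
    \<comment> \<open>Two errors of at most \<open>e / 4\<close>, each doubled by
      \<open>norm_add_power2_le\<close>, add up to at most \<open>e\<close>.\<close>
    then obtain n where n: "(\<integral>t. (cmod (\<Psi> n t - \<Phi> t))\<^sup>2 \<partial>period_measure b) < e / 4"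
      using order_tendstoD(2)[OF lim0, of "e / 4"] by (auto simp: eventually_sequentially)
    obtain p where p: "trig_poly b p" "(\<integral>t. (cmod (\<Psi> n t - p t))\<^sup>2 \<partial>period_measure b) \<le> e / 4"
      using approx[of n] e unfolding L2_approximable_def by (meson divide_pos_pos zero_less_numeral)
    have [measurable]: "p \<in> borel_measurable (period_measure b)"
      by (intro measurable_period borel_measurable_continuous_onI trig_poly_continuous[OF p(1)])
    obtain B where B: "\<And>t. cmod (p t) \<le> B" using trig_poly_bounded[OF p(1)] by blast
    have i1: "integrable (period_measure b) (\<lambda>t. (cmod (\<Psi> n t - p t))\<^sup>2)"
    proof (rule int_bound[where C = B])
      fix t assume "t \<in> {0..<1/b}"
      then show "cmod (\<Psi> n t - p t) \<le> G t + B"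
        using bound(2)[of t n] B[of t] norm_triangle_ineq4[of "\<Psi> n t" "p t"] by linarith
    qed simp
    have i2: "integrable (period_measure b) (\<lambda>t. (cmod (\<Psi> n t - \<Phi> t))\<^sup>2)"
    proof (rule Bochner_Integration.integrable_bound)
      show "integrable (period_measure b) (\<lambda>t. 4 * (G t)\<^sup>2)" using G by simp
      show "AE t in period_measure b. norm ((cmod (\<Psi> n t - \<Phi> t))\<^sup>2) \<le> norm (4 * (G t)\<^sup>2)"
      proof (rule AE_I2)
        fix t assume "t \<in> space (period_measure b)"
        then have t: "t \<in> {0..<1/b}" by (simp add: space_restrict_space)
        have "cmod (\<Psi> n t - \<Phi> t) \<le> 2 * G t"
          using bound(2)[OF t, of n] bound(1)[OF t] norm_triangle_ineq4[of "\<Psi> n t" "\<Phi> t"] by linarith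
        then have "(cmod (\<Psi> n t - \<Phi> t))\<^sup>2 \<le> (2 * G t)\<^sup>2" by (intro power_mono) auto
        then show "norm ((cmod (\<Psi> n t - \<Phi> t))\<^sup>2) \<le> norm (4 * (G t)\<^sup>2)" by (simp add: power_mult_distrib)
      qed
    qed simp
    have "(\<integral>t. (cmod (\<Phi> t - p t))\<^sup>2 \<partial>period_measure b)
        \<le> (\<integral>t. 2 * (cmod (\<Psi> n t - \<Phi> t))\<^sup>2 + 2 * (cmod (\<Psi> n t - p t))\<^sup>2 \<partial>period_measure b)"
    proof (rule integral_mono')
      fix t show "(cmod (\<Phi> t - p t))\<^sup>2 \<le> 2 * (cmod (\<Psi> n t - \<Phi> t))\<^sup>2 + 2 * (cmod (\<Psi> n t - p t))\<^sup>2"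
        using norm_add_power2_le[of "\<Phi> t - \<Psi> n t" "\<Psi> n t - p t"] by (simp add: norm_minus_commute)
    qed (use i1 i2 in auto)
    also have "\<dots> = 2 * (\<integral>t. (cmod (\<Psi> n t - \<Phi> t))\<^sup>2 \<partial>period_measure b) + 2 * (\<integral>t. (cmod (\<Psi> n t - p t))\<^sup>2 \<partial>period_measure b)"
      using i1 i2 by simp
    also have "\<dots> \<le> e" using n p(2) by linarith
    finally show "\<exists>p. trig_poly b p \<and> (\<integral>t. (cmod (\<Phi> t - p t))\<^sup>2 \<partial>period_measure b) \<le> e"
      using p(1) by blast
  qed
qed

lemma L2_approximable_continuous:
  fixes h :: "real \<Rightarrow> complex"
  assumes b: "0 < b" and h: "continuous_on {0..1/b} h" "h 0 = h (1/b)"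
  shows "L2_approximable b h"
  unfolding L2_approximable_def
proof (intro allI impI)
  interpret finite_measure "period_measure b" by (rule finite_measure_period[OF b])
  fix e :: real assume e: "0 < e"
  \<comment> \<open>Squared and integrated over a period of length \<open>1/b\<close>, a uniform
    error of this size contributes \<open>e\<close>.\<close>
  then have "0 < sqrt (e * b)" using b by simp
  then obtain p where p: "trig_poly b p" "\<And>t. t \<in> {0..<1/b} \<Longrightarrow> cmod (h t - p t) < sqrt (e * b)"
    using trig_poly_uniform_approx[OF b h] by blast
  have "(\<integral>t. (cmod (h t - p t))\<^sup>2 \<partial>period_measure b) \<le> (\<integral>t. e * b \<partial>period_measure b)"
  proof (rule integral_mono')
    fix t assume "t \<in> space (period_measure b)"
    then have "cmod (h t - p t) \<le> sqrt (e * b)"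
      using p(2)[of t] by (auto simp: space_restrict_space)
    then have "(cmod (h t - p t))\<^sup>2 \<le> (sqrt (e * b))\<^sup>2" by (intro power_mono) auto
    then show "(cmod (h t - p t))\<^sup>2 \<le> e * b" using e b by simp
  qed (use e b in auto)
  also have "\<dots> = e" using measure_period[OF b] b by (simp add: space_restrict_space)
  finally show "\<exists>p. trig_poly b p \<and> (\<integral>t. (cmod (h t - p t))\<^sup>2 \<partial>period_measure b) \<le> e"
    using p(1) by blast
qed

text \<open>For \<open>M > 0\<close> this is the radial retraction onto the closed disc of radius
  \<open>M\<close>.\<close>

definition clamp_norm :: "real \<Rightarrow> complex \<Rightarrow> complex" where
  "clamp_norm M x = (M / max M (cmod x)) *\<^sub>R x"

lemma clamp_norm_eq: "0 < M \<Longrightarrow> cmod x \<le> M \<Longrightarrow> clamp_norm M x = x"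
  by (simp add: clamp_norm_def max_def)

lemma norm_clamp_norm_le:
  assumes "0 < M"
  shows "cmod (clamp_norm M x) \<le> M" "cmod (clamp_norm M x) \<le> cmod x"
  using assms by (auto simp: clamp_norm_def max_def field_simps)

lemma continuous_on_clamp_norm: "0 < M \<Longrightarrow> continuous_on S (clamp_norm M)"
  unfolding clamp_norm_def by (intro continuous_intros) auto

text \<open>A measurable function is almost everywhere a limit of continuous ones. Clamping
  preserves their continuity and bounds them by \<open>M\<close>, so dominated convergence
  applies.\<close>

lemma L2_approximable_bounded:
  fixes \<Phi> :: "real \<Rightarrow> complex"
  assumes b: "0 < b" and meas: "\<Phi> \<in> borel_measurable borel" and M: "0 < M" "\<And>t. cmod (\<Phi> t) \<le> M"
  shows "L2_approximable b \<Phi>"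
proof -
  interpret finite_measure "period_measure b" by (rule finite_measure_period[OF b])
  have "\<Phi> measurable_on UNIV"
    using meas by (intro lebesgue_measurable_imp_measurable_on) (auto intro: measurable_completion)
  then obtain N g where N: "negligible N" and g: "\<And>n. continuous_on UNIV (g n)"
      and gl: "\<And>x. x \<notin> N \<Longrightarrow> (\<lambda>n. g n x) \<longlonglongrightarrow> \<Phi> x"
    unfolding measurable_on_def by auto
  define cut where "cut n t = min 1 (real n * (t * (1/b - t)))" for n t
  \<comment> \<open>The cutoff forces equal values at the ends of the period.\<close>
  define \<Psi> where "\<Psi> n t = of_real (cut n t) * clamp_norm M (g n t)" for n t
  have cont: "continuous_on S (\<Psi> n)" for S n
    unfolding \<Psi>_def cut_def
    by (intro continuous_intros continuous_on_compose2[OF continuous_on_clamp_norm[OF M(1), of UNIV]]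
        continuous_on_subset[OF g]) auto
  show ?thesis
  proof (rule L2_approximable_limit[OF b meas, where \<Psi> = \<Psi> and G = "\<lambda>t. M"])
    show "\<Psi> n \<in> borel_measurable borel" for n
      by (intro borel_measurable_continuous_onI cont)
    show "L2_approximable b (\<Psi> n)" for n
      by (intro L2_approximable_continuous b cont) (simp add: \<Psi>_def cut_def)
    show "cmod (\<Psi> n t) \<le> M" if t: "t \<in> {0..<1/b}" for n t
    proof -
      have "0 \<le> cut n t" "cut n t \<le> 1" using t b by (auto simp: cut_def)
      then have "cmod (\<Psi> n t) \<le> 1 * M"
        unfolding \<Psi>_def norm_mult by (intro mult_mono norm_clamp_norm_le M) auto
      then show ?thesis by simp
    qed
    have "N \<in> null_sets lebesgue" using N by (simp add: negligible_iff_null_sets)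
    then have "AE t in lborel. t \<notin> N"
      by (rule AE_not_in[THEN AE_completion_iff[THEN iffD1]])
    \<comment> \<open>At 0 the cutoff vanishes for every \<open>n\<close>, so convergence may fail
      there; the point is discarded as a null set.\<close>
    moreover have "AE t in lborel. t \<noteq> (0::real)" by (rule AE_lborel_singleton)
    ultimately have "AE t in lborel. t \<in> {0..<1/b} \<longrightarrow> (\<lambda>n. \<Psi> n t) \<longlonglongrightarrow> \<Phi> t"
    proof eventually_elim
      case (elim t)
      show ?case
      proof
        assume "t \<in> {0..<1/b}"
        with elim have pos: "0 < t * (1/b - t)" by auto
        have "\<forall>\<^sub>F n in sequentially. cut n t = 1"
        proof -
          obtain n0 :: nat where n0: "1 < real n0 * (t * (1/b - t))"
            using reals_Archimedean3[OF pos] by blast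
          have "cut n t = 1" if "n \<ge> n0" for n
          proof -
            have "real n0 * (t * (1/b - t)) \<le> real n * (t * (1/b - t))"
              using that pos by (intro mult_right_mono) auto
            then show ?thesis using n0 by (simp add: cut_def)
          qed
          then show ?thesis unfolding eventually_sequentially by blast
        qed
        then have "(\<lambda>n. cut n t) \<longlonglongrightarrow> 1"
          by (rule tendsto_eventually)
        moreover have "(\<lambda>n. clamp_norm M (g n t)) \<longlonglongrightarrow> clamp_norm M (\<Phi> t)"
          by (rule continuous_on_tendsto_compose[OF continuous_on_clamp_norm[OF M(1), of UNIV] gl[OF elim(1)]]) simp_all
        ultimately have "(\<lambda>n. \<Psi> n t) \<longlonglongrightarrow> of_real 1 * clamp_norm M (\<Phi> t)"
          unfolding \<Psi>_def by (intro tendsto_intros)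
        then show "(\<lambda>n. \<Psi> n t) \<longlonglongrightarrow> \<Phi> t" using M by (simp add: clamp_norm_eq)
      qed
    qed
    then show "AE t in period_measure b. (\<lambda>n. \<Psi> n t) \<longlonglongrightarrow> \<Phi> t"
      by (simp add: AE_restrict_space_iff)
  qed (use M in auto)
qed

text \<open>Clamping at growing radii reduces to bounded functions, with \<open>\<Phi>\<close>
  itself as dominating function. \<open>Suc n\<close> keeps the radius positive.\<close>

lemma L2_approximable:
  fixes \<Phi> :: "real \<Rightarrow> complex"
  assumes b: "0 < b" and meas: "\<Phi> \<in> borel_measurable borel"
    and int: "integrable (period_measure b) (\<lambda>t. (cmod (\<Phi> t))\<^sup>2)"
  shows "L2_approximable b \<Phi>"
proof -
  define \<Psi> where "\<Psi> n t = clamp_norm (real (Suc n)) (\<Phi> t)" for n t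
  have cm [measurable]: "clamp_norm (real (Suc n)) \<in> borel_measurable borel" for n
    by (intro borel_measurable_continuous_onI continuous_on_clamp_norm) simp
  have m: "\<Psi> n \<in> borel_measurable borel" for n
    unfolding \<Psi>_def using measurable_compose[OF meas cm] .
  show ?thesis
  proof (rule L2_approximable_limit[OF b meas m, where G = "\<lambda>t. cmod (\<Phi> t)"])
    show "L2_approximable b (\<Psi> n)" for n
      by (rule L2_approximable_bounded[OF b m, of "real (Suc n)"]) (auto simp: \<Psi>_def norm_clamp_norm_le)
    have "(\<lambda>n. \<Psi> n t) \<longlonglongrightarrow> \<Phi> t" for t
    proof (rule tendsto_eventually)
      obtain n0 where "cmod (\<Phi> t) \<le> real n0" using real_arch_simple by blast
      then have "\<Psi> n t = \<Phi> t" if "n \<ge> n0" for n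
        unfolding \<Psi>_def using that by (intro clamp_norm_eq) auto
      then show "\<forall>\<^sub>F n in sequentially. \<Psi> n t = \<Phi> t" unfolding eventually_sequentially by blast
    qed
    then show "AE t in period_measure b. (\<lambda>n. \<Psi> n t) \<longlonglongrightarrow> \<Phi> t" by simp
  qed (auto simp: \<Psi>_def norm_clamp_norm_le int)
qed

section \<open>Fourier coefficients on one period: orthogonality, Bessel and Parseval\<close>

lemma integral_cis_period:
  assumes b: "0 < b"
  shows "(\<integral>t. cis (2 * pi * b * of_int m * t) \<partial>period_measure b) = (if m = 0 then of_real (1 / b) else 0)"
proof (cases "m = 0")
  case True
  then show ?thesis
    using measure_period[OF b] by (simp add: space_restrict_space scaleR_conv_of_real)
next
  case False
  define w where "w = 2 * pi * b * of_int m"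
  have w: "w \<noteq> 0" using False b by (simp add: w_def)
  define F where "F t = cis (w * t) / (\<i> * of_real w)" for t
  have "(\<integral>t. cis (w * t) \<partial>period_measure b) = (\<integral>t. indicator {0..<1/b} t *\<^sub>R cis (w * t) \<partial>lborel)"
    by (rule integral_restrict_space) simp
  \<comment> \<open>Adding the right end, a null set, gives the closed interval on which the
    fundamental theorem of calculus is applied.\<close>
  also have "\<dots> = (\<integral>t. indicator {0..1/b} t *\<^sub>R cis (w * t) \<partial>lborel)"
  proof (rule integral_cong_AE)
    have "AE t in lborel. t \<noteq> 1/b" by (rule AE_lborel_singleton)
    then show "AE t in lborel. indicator {0..<1/b} t *\<^sub>R cis (w * t) = indicator {0..1/b} t *\<^sub>R cis (w * t)"
      by eventually_elim (auto simp: indicator_def)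
    have [measurable]: "(\<lambda>t. cis (w * t)) \<in> borel_measurable lborel"
      by (simp add: borel_measurable_continuous_onI continuous_intros)
    show "(\<lambda>t. indicator {0..<1/b} t *\<^sub>R cis (w * t)) \<in> borel_measurable lborel"
      "(\<lambda>t. indicator {0..1/b} t *\<^sub>R cis (w * t)) \<in> borel_measurable lborel" by measurable
  qed
  also have "\<dots> = F (1/b) - F 0"
  proof (rule integral_FTC_atLeastAtMost)
    fix t
    have "((\<lambda>z. exp (\<i> * (of_real w * z)) / (\<i> * of_real w)) has_field_derivative exp (\<i> * (of_real w * of_real t))) (at (of_real t))"
      using w by (auto intro!: derivative_eq_intros simp: mult.commute[of "exp _" "\<i>"])
    from has_vector_derivative_real_field[OF this]
    show "(F has_vector_derivative cis (w * t)) (at t within {0..1/b})"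
      by (simp add: F_def[abs_def] cis_conv_exp has_vector_derivative_at_within)
  qed (use b in \<open>auto intro!: continuous_intros\<close>)
  also have "F (1/b) = F 0"
  proof -
    have "w * (1/b) = 2 * pi * of_int m" using b by (simp add: w_def)
    then show ?thesis by (simp add: F_def cis_multiple_2pi)
  qed
  finally show ?thesis using False by (simp add: w_def)
qed

lemma borel_measurable_cis_mult [measurable]: "(\<lambda>t. cis (c * t)) \<in> borel_measurable borel"
  by (intro borel_measurable_continuous_onI continuous_intros)

text \<open>Not divided by the period: the characters have squared norm \<open>1/b\<close>, so
  Parseval carries the factor \<open>1/b\<close> and the best coefficients in mean square are
  \<open>b * fourier_coeff b \<Phi> m\<close>.\<close>

definition fourier_coeff :: "real \<Rightarrow> (real \<Rightarrow> complex) \<Rightarrow> int \<Rightarrow> complex" where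
  "fourier_coeff b \<Phi> m = (\<integral>t. \<Phi> t * cnj (cis (2 * pi * b * of_int m * t)) \<partial>period_measure b)"

context
  fixes b :: real and \<Phi> :: "real \<Rightarrow> complex"
  assumes b: "0 < b" and meas: "\<Phi> \<in> borel_measurable borel"
    and int: "integrable (period_measure b) (\<lambda>t. (cmod (\<Phi> t))\<^sup>2)"
begin

interpretation finite_measure "period_measure b" by (rule finite_measure_period[OF b])

lemma integrable_mult_cis: "integrable (period_measure b) (\<lambda>t. \<Phi> t * cnj (cis (2 * pi * b * of_int m * t)))"
proof (rule Bochner_Integration.integrable_bound)
  show "integrable (period_measure b) (\<lambda>t. 1 + (cmod (\<Phi> t))\<^sup>2)" using int by simp
  have "x \<le> 1 + x\<^sup>2" for x :: real
    using sum_squares_bound[of x 1] zero_le_power2[of x] by (smt (verit) one_power2 power2_eq_square)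
  then show "AE t in period_measure b. norm (\<Phi> t * cnj (cis (2 * pi * b * of_int m * t))) \<le> norm (1 + (cmod (\<Phi> t))\<^sup>2)"
    by (simp add: norm_mult)
  show "(\<lambda>t. \<Phi> t * cnj (cis (2 * pi * b * of_int m * t))) \<in> borel_measurable (period_measure b)"
    unfolding cis_cnj using borel_measurable_cis_mult[of "- (2 * pi * b * of_int m)"] meas
    by (intro measurable_period borel_measurable_times) simp_all
qed

text \<open>Expand the square, use orthogonality and complete the square for each frequency. Bessel
  and Parseval both come from this identity: the first by making the last sum vanish, the second by
  dropping it.\<close>

lemma integral_dist_trig_poly:
  assumes F: "finite F"
  shows "1 / b * (\<integral>t. (cmod (\<Phi> t - (\<Sum>m\<in>F. \<alpha> m * cis (2 * pi * b * of_int m * t))))\<^sup>2 \<partial>period_measure b)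
     = 1 / b * (\<integral>t. (cmod (\<Phi> t))\<^sup>2 \<partial>period_measure b) - (\<Sum>m\<in>F. (cmod (fourier_coeff b \<Phi> m))\<^sup>2)
        + (\<Sum>m\<in>F. (cmod (fourier_coeff b \<Phi> m - \<alpha> m / b))\<^sup>2)"
proof -
  define e where "e m t = cis (2 * pi * b * of_int m * t)" for m t
  define p where "p t = (\<Sum>m\<in>F. \<alpha> m * e m t)" for t
  have pm: "p \<in> borel_measurable (period_measure b)"
    unfolding p_def e_def by (intro measurable_period borel_measurable_continuous_onI continuous_intros)
  have ee: "e m t * cnj (e n t) = cis (2 * pi * b * of_int (m - n) * t)" for m n t
    unfolding e_def cis_cnj cis_mult by (rule arg_cong[where f = cis]) (simp add: algebra_simps)
  have iee: "integrable (period_measure b) (\<lambda>t. e m t * cnj (e n t))" for m n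
  proof (rule integrable_const_bound[where B = 1])
    show "(\<lambda>t. e m t * cnj (e n t)) \<in> borel_measurable (period_measure b)"
      unfolding ee by (intro measurable_period borel_measurable_cis_mult)
  qed (simp add: ee)
  have orth: "(\<integral>t. e m t * cnj (e n t) \<partial>period_measure b) = (if m = n then of_real (1 / b) else 0)" for m n
    unfolding ee integral_cis_period[OF b] by simp
  have i\<Phi>: "integrable (period_measure b) (\<lambda>t. \<Phi> t * cnj (e m t))" for m
    unfolding e_def by (rule integrable_mult_cis)
  have cross: "(\<lambda>t. \<Phi> t * cnj (p t)) = (\<lambda>t. \<Sum>m\<in>F. cnj (\<alpha> m) * (\<Phi> t * cnj (e m t)))"
    by (simp add: fun_eq_iff p_def cnj_sum sum_distrib_left mult.left_commute)
  have ic: "integrable (period_measure b) (\<lambda>t. \<Phi> t * cnj (p t))"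
    unfolding cross by (intro Bochner_Integration.integrable_sum integrable_mult_right i\<Phi>)
  have vc: "(\<integral>t. \<Phi> t * cnj (p t) \<partial>period_measure b) = (\<Sum>m\<in>F. cnj (\<alpha> m) * fourier_coeff b \<Phi> m)"
    unfolding cross using i\<Phi> by (simp add: fourier_coeff_def e_def)
  have sq: "(\<lambda>t. p t * cnj (p t)) = (\<lambda>t. \<Sum>m\<in>F. \<Sum>n\<in>F. \<alpha> m * cnj (\<alpha> n) * (e m t * cnj (e n t)))"
    by (simp add: fun_eq_iff p_def cnj_sum sum_product mult_ac)
  have ip: "integrable (period_measure b) (\<lambda>t. p t * cnj (p t))"
    unfolding sq by (intro Bochner_Integration.integrable_sum integrable_mult_right iee)
  have "(\<integral>t. p t * cnj (p t) \<partial>period_measure b) = (\<Sum>m\<in>F. \<Sum>n\<in>F. \<alpha> m * cnj (\<alpha> n) * (if m = n then of_real (1 / b) else 0))"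
    unfolding sq using iee by (simp add: orth)
  also have "\<dots> = (\<Sum>m\<in>F. \<alpha> m * cnj (\<alpha> m) * of_real (1 / b))"
    using F by (intro sum.cong refl) (simp add: if_distrib[where f = "\<lambda>x. _ * x"] cong: if_cong)
  also have "\<dots> = of_real (1 / b * (\<Sum>m\<in>F. (cmod (\<alpha> m))\<^sup>2))"
    by (simp add: complex_norm_square[symmetric] sum_distrib_left mult.commute del: of_real_power)
  finally have vp: "(\<integral>t. p t * cnj (p t) \<partial>period_measure b) = of_real (1 / b * (\<Sum>m\<in>F. (cmod (\<alpha> m))\<^sup>2))" .
  have lin: "(\<integral>t. x t - 2 * y t + z t \<partial>M) = (\<integral>t. x t \<partial>M) - 2 * (\<integral>t. y t \<partial>M) + (\<integral>t. z t \<partial>M)"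
    if "integrable M x" "integrable M y" "integrable M z" for M :: "real measure" and x y z :: "real \<Rightarrow> real"
    using that by simp
  have "(cmod (\<Phi> t - p t))\<^sup>2 = (cmod (\<Phi> t))\<^sup>2 - 2 * Re (\<Phi> t * cnj (p t)) + Re (p t * cnj (p t))" for t
    unfolding cmod_power2 by (simp add: power2_eq_square algebra_simps)
  then have "(\<integral>t. (cmod (\<Phi> t - p t))\<^sup>2 \<partial>period_measure b)
     = (\<integral>t. (cmod (\<Phi> t))\<^sup>2 \<partial>period_measure b) - 2 * Re (\<integral>t. \<Phi> t * cnj (p t) \<partial>period_measure b)
        + Re (\<integral>t. p t * cnj (p t) \<partial>period_measure b)"
    by (simp only: lin[OF int integrable_Re[OF ic] integrable_Re[OF ip]] integral_Re[OF ic] integral_Re[OF ip])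
  also have "\<dots> = (\<integral>t. (cmod (\<Phi> t))\<^sup>2 \<partial>period_measure b) + (\<Sum>m\<in>F. 1 / b * (cmod (\<alpha> m))\<^sup>2 - 2 * Re (cnj (\<alpha> m) * fourier_coeff b \<Phi> m))"
    unfolding vc vp by (simp add: sum_subtractf sum_distrib_left)
  finally have *: "(\<integral>t. (cmod (\<Phi> t - p t))\<^sup>2 \<partial>period_measure b) = \<dots>" .
  have alg: "1 / b * (1 / b * (cmod a)\<^sup>2 - 2 * Re (cnj a * c)) = (cmod (c - a / b))\<^sup>2 - (cmod c)\<^sup>2" for a c :: complex
    unfolding cmod_power2 using b by (simp add: power2_eq_square field_simps)
  have "1 / b * (\<Sum>m\<in>F. 1 / b * (cmod (\<alpha> m))\<^sup>2 - 2 * Re (cnj (\<alpha> m) * fourier_coeff b \<Phi> m))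
     = (\<Sum>m\<in>F. (cmod (fourier_coeff b \<Phi> m - \<alpha> m / b))\<^sup>2) - (\<Sum>m\<in>F. (cmod (fourier_coeff b \<Phi> m))\<^sup>2)"
    by (simp only: sum_subtractf[symmetric] sum_distrib_left alg)
  then show ?thesis
    using * unfolding p_def e_def by (simp only: distrib_left)
qed

lemma bessel_inequality:
  assumes F: "finite F"
  shows "(\<Sum>m\<in>F. (cmod (fourier_coeff b \<Phi> m))\<^sup>2) \<le> 1 / b * (\<integral>t. (cmod (\<Phi> t))\<^sup>2 \<partial>period_measure b)"
proof -
  \<comment> \<open>The coefficients \<open>b * fourier_coeff b \<Phi> m\<close> are those of the
    orthogonal projection, for which the last sum of the identity is 0.\<close>
  have "0 \<le> 1 / b * (\<integral>t. (cmod (\<Phi> t - (\<Sum>m\<in>F. (b * fourier_coeff b \<Phi> m) * cis (2 * pi * b * of_int m * t))))\<^sup>2 \<partial>period_measure b)"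
    using b by (intro mult_nonneg_nonneg integral_nonneg_AE) auto
  also have "\<dots> = 1 / b * (\<integral>t. (cmod (\<Phi> t))\<^sup>2 \<partial>period_measure b) - (\<Sum>m\<in>F. (cmod (fourier_coeff b \<Phi> m))\<^sup>2)"
    unfolding integral_dist_trig_poly[OF F] using b by simp
  finally show ?thesis by simp
qed

text \<open>Density gives a trigonometric polynomial within \<open>e * b\<close> of
  \<open>\<Phi>\<close>, and its frequencies serve as \<open>F\<close>. Equality up to
  \<open>e\<close> over a finite set is all that the lower frame bound needs.\<close>

lemma parseval_approx:
  assumes e: "0 < e"
  obtains F where "finite F"
    "1 / b * (\<integral>t. (cmod (\<Phi> t))\<^sup>2 \<partial>period_measure b) \<le> (\<Sum>m\<in>F. (cmod (fourier_coeff b \<Phi> m))\<^sup>2) + e"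
proof -
  obtain p where p: "trig_poly b p" "(\<integral>t. (cmod (\<Phi> t - p t))\<^sup>2 \<partial>period_measure b) \<le> e * b"
    using L2_approximable[OF b meas int] e b unfolding L2_approximable_def by (meson mult_pos_pos)
  obtain F \<alpha> where F: "finite F" "p = (\<lambda>t. \<Sum>m\<in>F. \<alpha> m * cis (2 * pi * b * of_int m * t))"
    using trig_poly_expansion[OF p(1)] by blast
  have "1 / b * (\<integral>t. (cmod (\<Phi> t - p t))\<^sup>2 \<partial>period_measure b) \<le> e"
    using p(2) b by (simp add: field_simps)
  then have "1 / b * (\<integral>t. (cmod (\<Phi> t))\<^sup>2 \<partial>period_measure b) - (\<Sum>m\<in>F. (cmod (fourier_coeff b \<Phi> m))\<^sup>2)
        + (\<Sum>m\<in>F. (cmod (fourier_coeff b \<Phi> m - \<alpha> m / b))\<^sup>2) \<le> e"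
    unfolding F(2) integral_dist_trig_poly[OF F(1)] .
  moreover have "0 \<le> (\<Sum>m\<in>F. (cmod (fourier_coeff b \<Phi> m - \<alpha> m / b))\<^sup>2)" by (intro sum_nonneg) simp
  ultimately show ?thesis using that[OF F(1)] by linarith
qed

end

section \<open>Fibers of the Gabor system\<close>

lemma inverse_cosh_le: "1 / cosh (x::real) \<le> 2 * exp (- \<bar>x\<bar>)"
proof -
  have "exp \<bar>x\<bar> / 2 \<le> cosh x"
    by (cases "x \<ge> 0") (auto simp: cosh_def)
  then have "1 / cosh x \<le> 1 / (exp \<bar>x\<bar> / 2)" by (intro divide_left_mono) auto
  then show ?thesis by (simp add: exp_minus divide_simps)
qed

text \<open>Let \<open>k0\<close> index the lattice point nearest to 0. The others lie at distance
  at least \<open>h\<close> times the index distance minus \<open>h / 2\<close>, so a geometric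
  series dominates, uniformly in \<open>x\<close>.\<close>

lemma sum_sech_lattice_le:
  fixes K :: "int set" and \<kappa> h x :: real
  assumes "0 < \<kappa>" "0 < h" "finite K"
  shows "(\<Sum>k\<in>K. 1 / cosh (\<kappa> * (x + of_int k * h))) \<le> 4 * exp (\<kappa> * h / 2) / (1 - exp (- (\<kappa> * h)))"
proof -
  define k0 where "k0 = round (- x / h)"
  have r: "\<bar>x + of_int k0 * h\<bar> \<le> h / 2"
  proof -
    have "\<bar>of_int k0 - (- x / h)\<bar> * h \<le> 1 / 2 * h"
      unfolding k0_def using assms(2) by (intro mult_right_mono of_int_round_abs_le) auto
    moreover have "\<bar>of_int k0 - (- x / h)\<bar> * h = \<bar>(of_int k0 - (- x / h)) * h\<bar>"
      using assms(2) by (simp add: abs_mult)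
    moreover have "(of_int k0 - (- x / h)) * h = x + of_int k0 * h"
      using assms(2) by (simp add: field_simps)
    ultimately show ?thesis by simp
  qed
  have "1 / cosh (\<kappa> * (x + of_int k * h)) \<le> 2 * exp (\<kappa> * h / 2) * exp (- (\<kappa> * h)) ^ nat \<bar>k - k0\<bar>" for k
  proof -
    have "real (nat \<bar>k - k0\<bar>) * h = \<bar>(of_int k - of_int k0) * h\<bar>"
      using assms(2) by (simp add: abs_mult)
    also have "\<dots> = \<bar>(x + of_int k * h) - (x + of_int k0 * h)\<bar>" by (simp add: algebra_simps)
    also have "\<dots> \<le> \<bar>x + of_int k * h\<bar> + h / 2" using r by linarith
    finally have "\<kappa> * (real (nat \<bar>k - k0\<bar>) * h) \<le> \<kappa> * (\<bar>x + of_int k * h\<bar> + h / 2)"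
      using assms(1) by (intro mult_left_mono) auto
    also have "\<dots> = \<bar>\<kappa> * (x + of_int k * h)\<bar> + \<kappa> * h / 2"
      using assms(1) by (subst abs_mult) (simp add: distrib_left)
    finally have "- \<bar>\<kappa> * (x + of_int k * h)\<bar> \<le> \<kappa> * h / 2 + real (nat \<bar>k - k0\<bar>) * (- (\<kappa> * h))"
      by (simp add: mult.left_commute)
    then have "exp (- \<bar>\<kappa> * (x + of_int k * h)\<bar>) \<le> exp (\<kappa> * h / 2) * exp (- (\<kappa> * h)) ^ nat \<bar>k - k0\<bar>"
      unfolding exp_of_nat_mult[symmetric] exp_add[symmetric] exp_le_cancel_iff .
    then show ?thesis using inverse_cosh_le[of "\<kappa> * (x + of_int k * h)"] by linarith
  qed
  then have "(\<Sum>k\<in>K. 1 / cosh (\<kappa> * (x + of_int k * h)))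
      \<le> (\<Sum>k\<in>K. 2 * exp (\<kappa> * h / 2) * exp (- (\<kappa> * h)) ^ nat \<bar>k - k0\<bar>)"
    by (rule sum_mono)
  also have "\<dots> \<le> 2 * exp (\<kappa> * h / 2) * (2 / (1 - exp (- (\<kappa> * h))))"
    unfolding sum_distrib_left[symmetric] using assms
    by (intro mult_left_mono sum_power_abs_diff_le) auto
  finally show ?thesis by simp
qed

locale sech_gabor =
  fixes \<gamma> a b :: real
  assumes \<gamma>: "0 < \<gamma>" and a: "0 < a" and b: "0 < b" and ab: "a * b < 1"
begin

definition sech_const :: real where "sech_const = sqrt (pi * \<gamma> / 2)"

definition w :: "real \<Rightarrow> real" where "w t = sech_const * (1 / cosh (pi * \<gamma> * t))"

lemma sech_const_pos: "0 < sech_const" using \<gamma> by (simp add: sech_const_def)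

lemma w_nonneg: "0 \<le> w t" using sech_const_pos by (simp add: w_def)

lemma sech_window_eq: "sech_window \<gamma> t = of_real (w t)"
  by (simp add: sech_window_def w_def sech_const_def)

lemma a_less: "a < 1 / b" using ab b by (simp add: field_simps)

definition row_bound :: "real \<Rightarrow> real" where
  "row_bound h = sech_const * (4 * exp (pi * \<gamma> * h / 2) / (1 - exp (- (pi * \<gamma> * h))))"

lemma row_bound_nonneg: "0 < h \<Longrightarrow> 0 \<le> row_bound h"
  using sech_const_pos \<gamma> by (auto simp: row_bound_def intro!: mult_nonneg_nonneg divide_nonneg_nonneg)

lemma sum_w_le: "0 < h \<Longrightarrow> finite K \<Longrightarrow> (\<Sum>k\<in>K. w (x + of_int k * h)) \<le> row_bound h"
  unfolding w_def row_bound_def sum_distrib_left[symmetric]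
  using sech_const_pos \<gamma> by (intro mult_left_mono sum_sech_lattice_le) auto

definition upper_const :: real where "upper_const = row_bound (1 / b) * row_bound a"

lemma upper_const_nonneg: "0 \<le> upper_const"
  unfolding upper_const_def using a b by (intro mult_nonneg_nonneg row_bound_nonneg) auto

text \<open>For fixed \<open>n\<close> the arguments run through a lattice of spacing
  \<open>1/b\<close>, for fixed \<open>k\<close> through one of spacing \<open>a\<close>; both
  families of sums are bounded uniformly in \<open>t\<close>.\<close>

lemma fiber_upper:
  fixes c :: "int \<Rightarrow> complex"
  assumes "finite K" "finite F"
  shows "(\<Sum>n\<in>F. (cmod (\<Sum>k\<in>K. of_real (w (t + of_int k / b - of_int n * a)) * c k))\<^sup>2)
    \<le> upper_const * (\<Sum>k\<in>K. (cmod (c k))\<^sup>2)"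
  unfolding upper_const_def
proof (rule schur_test)
  fix n assume "n \<in> F"
  have "(\<Sum>k\<in>K. \<bar>w (t + of_int k / b - of_int n * a)\<bar>) = (\<Sum>k\<in>K. w ((t - of_int n * a) + of_int k * (1 / b)))"
    by (intro sum.cong refl) (simp add: w_nonneg algebra_simps)
  also have "\<dots> \<le> row_bound (1 / b)" using b assms by (intro sum_w_le) auto
  finally show "(\<Sum>k\<in>K. \<bar>w (t + of_int k / b - of_int n * a)\<bar>) \<le> row_bound (1 / b)" .
next
  fix k assume "k \<in> K"
  have w_even: "w (- x) = w x" for x by (simp add: w_def)
  have "(\<Sum>n\<in>F. \<bar>w (t + of_int k / b - of_int n * a)\<bar>) = (\<Sum>n\<in>F. w (- (t + of_int k / b) + of_int n * a))"
  proof (intro sum.cong refl)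
    fix n
    have "w (t + of_int k / b - of_int n * a) = w (- (t + of_int k / b - of_int n * a))" by (simp only: w_even)
    moreover have "- (t + of_int k / b - of_int n * a) = - (t + of_int k / b) + of_int n * a" by simp
    ultimately show "\<bar>w (t + of_int k / b - of_int n * a)\<bar> = w (- (t + of_int k / b) + of_int n * a)"
      by (metis abs_of_nonneg w_nonneg)
  qed
  also have "\<dots> \<le> row_bound a" using a assms by (intro sum_w_le) auto
  finally show "(\<Sum>n\<in>F. \<bar>w (t + of_int k / b - of_int n * a)\<bar>) \<le> row_bound a" .
qed (use b row_bound_nonneg in auto)

text \<open>The summand 1 only serves to make the constant positive.\<close>

definition lower_const :: real where
  "lower_const = (2 * sech_nodes.inv_const (pi * \<gamma> / b) (pi * \<gamma> * a / 2) / (1 - exp (- (pi * \<gamma> / b - 2 * (pi * \<gamma> * a / 2)))))\<^sup>2 / sech_const\<^sup>2 + 1"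

lemma lower_const_pos: "0 < lower_const"
  unfolding lower_const_def by (intro add_nonneg_pos) auto

text \<open>The rows \<open>\<nu> k\<close> give an instance of \<open>sech_nodes\<close>, in which
  \<open>2 * d < l\<close> says \<open>a < 1 / b\<close>. They are distinct, and further rows in
  \<open>F\<close> only add nonnegative terms. The constant does not involve
  \<open>t\<close>.\<close>

lemma fiber_lower:
  fixes c :: "int \<Rightarrow> complex"
  assumes K: "finite K" and F: "finite F" "\<And>k. k \<in> K \<Longrightarrow> round ((t + of_int k / b) / a) \<in> F"
  shows "(\<Sum>k\<in>K. (cmod (c k))\<^sup>2)
    \<le> lower_const * (\<Sum>n\<in>F. (cmod (\<Sum>k\<in>K. of_real (w (t + of_int k / b - of_int n * a)) * c k))\<^sup>2)"
proof -
  define \<nu> where "\<nu> k = round ((t + of_int k / b) / a)" for k :: int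
  define p where "p k = pi * \<gamma> * (of_int (\<nu> k) * a)" for k
  define q where "q k = pi * \<gamma> * (t + of_int k / b)" for k :: int
  interpret sech_nodes p q "pi * \<gamma> / b" "pi * \<gamma> * a / 2"
  proof
    show "q m - q k = pi * \<gamma> / b * (of_int m - of_int k)" for m k
      by (simp add: q_def algebra_simps diff_divide_distrib)
    show "\<bar>p m - q m\<bar> \<le> pi * \<gamma> * a / 2" for m
    proof -
      have "p m - q m = (pi * \<gamma> * a) * (of_int (\<nu> m) - (t + of_int m / b) / a)"
        using a by (simp add: p_def q_def field_simps)
      then have "\<bar>p m - q m\<bar> = (pi * \<gamma> * a) * \<bar>of_int (\<nu> m) - (t + of_int m / b) / a\<bar>"
        using \<gamma> a by (simp add: abs_mult)
      also have "\<dots> \<le> (pi * \<gamma> * a) * (1 / 2)"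
        unfolding \<nu>_def using \<gamma> a by (intro mult_left_mono of_int_round_abs_le) auto
      finally show ?thesis by simp
    qed
    have "pi * \<gamma> * a < pi * \<gamma> * (1 / b)"
      using a_less \<gamma> by (intro mult_strict_left_mono) auto
    then show "2 * (pi * \<gamma> * a / 2) < pi * \<gamma> / b" by simp
  qed
  have inj: "inj_on \<nu> K"
  proof (rule linorder_inj_onI')
    fix i j :: int assume "i < j"
    then have "p i < p j" by (rule p_less)
    then show "\<nu> i \<noteq> \<nu> j" unfolding p_def by auto
  qed
  let ?V = "\<lambda>n. (cmod (\<Sum>k\<in>K. of_real (w (t + of_int k / b - of_int n * a)) * c k))\<^sup>2"
  have V: "(cmod (\<Sum>k\<in>K. of_real (1 / cosh (q k - p n)) * c k))\<^sup>2 = ?V (\<nu> n) / sech_const\<^sup>2" for n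
  proof -
    have "w (t + of_int k / b - of_int (\<nu> n) * a) = sech_const * (1 / cosh (q k - p n))" for k
      by (simp add: w_def q_def p_def right_diff_distrib)
    then have "(\<Sum>k\<in>K. of_real (w (t + of_int k / b - of_int (\<nu> n) * a)) * c k)
        = of_real sech_const * (\<Sum>k\<in>K. of_real (1 / cosh (q k - p n)) * c k)"
      by (simp add: sum_distrib_left mult.assoc)
    then show ?thesis using sech_const_pos by (simp add: norm_mult power_mult_distrib)
  qed
  define Q where "Q = (2 * inv_const / (1 - exp (- (pi * \<gamma> / b - 2 * (pi * \<gamma> * a / 2)))))\<^sup>2"
  have "(\<Sum>k\<in>K. (cmod (c k))\<^sup>2) \<le> Q * (\<Sum>n\<in>K. ?V (\<nu> n) / sech_const\<^sup>2)"
    using sech_matrix_lower_bound[OF K, of c] unfolding V Q_def .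
  also have "\<dots> = Q / sech_const\<^sup>2 * (\<Sum>n\<in>\<nu> ` K. ?V n)"
    using inj by (simp add: sum.reindex sum_divide_distrib[symmetric])
  also have "\<dots> \<le> lower_const * (\<Sum>n\<in>F. ?V n)"
    unfolding lower_const_def Q_def
    using F by (intro mult_mono sum_mono2 sum_nonneg) (auto simp: \<nu>_def)
  finally show ?thesis .
qed

end

section \<open>Folding an integral over the line onto one period\<close>

lemma lborel_integral_split_period:
  fixes h :: "real \<Rightarrow> 'a::{banach, second_countable_topology}"
  assumes b: "0 < b" and h: "integrable lborel h" and K: "finite K"
    and supp: "\<And>t. \<lfloor>b * t\<rfloor> \<notin> K \<Longrightarrow> h t = 0"
  shows "\<And>k. integrable (period_measure b) (\<lambda>t. h (t + of_int k / b))"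
    and "(\<integral>t. h t \<partial>lborel) = (\<Sum>k\<in>K. \<integral>t. h (t + of_int k / b) \<partial>period_measure b)"
proof -
  \<comment> \<open>Half-open cells partition the line, and \<open>\<lfloor>b * t\<rfloor>\<close>
    is the index of the cell of \<open>t\<close>; by \<open>supp\<close> only those in
    \<open>K\<close> matter.\<close>
  define I where "I k = {of_int k / b..<(of_int k + 1) / b}" for k :: int
  have fl: "t \<in> I k \<longleftrightarrow> \<lfloor>b * t\<rfloor> = k" for t k
    using b by (auto simp: I_def floor_eq_iff field_simps)
  have shift: "indicator (I k) (of_int k / b + 1 * t) = (indicator {0..<1/b} t :: real)" for k t
    by (auto simp: I_def indicator_def add_divide_distrib)
  have int_I: "integrable lborel (\<lambda>t. indicator (I k) t *\<^sub>R h t)" for k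
    using h by (intro integrable_mult_indicator) (auto simp: I_def)
  have int_k: "integrable lborel (\<lambda>t. indicator {0..<1/b} t *\<^sub>R h (t + of_int k / b))" for k
    using lborel_integrable_real_affine[OF int_I[of k], of 1 "of_int k / b"] unfolding shift
    by (simp add: add.commute)
  then show "integrable (period_measure b) (\<lambda>t. h (t + of_int k / b))" for k
    by (subst integrable_restrict_space) auto
  have "h t = (\<Sum>k\<in>K. indicator (I k) t *\<^sub>R h t)" for t
  proof -
    have "(\<Sum>k\<in>K. indicator (I k) t *\<^sub>R h t) = (\<Sum>k\<in>K. if k = \<lfloor>b * t\<rfloor> then h t else 0)"
      by (intro sum.cong refl) (auto simp: fl indicator_def)
    then show ?thesis using K supp[of t] by simp
  qed
  then have "(\<integral>t. h t \<partial>lborel) = (\<integral>t. (\<Sum>k\<in>K. indicator (I k) t *\<^sub>R h t) \<partial>lborel)" by simp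
  also have "\<dots> = (\<Sum>k\<in>K. \<integral>t. indicator (I k) t *\<^sub>R h t \<partial>lborel)"
    using int_I by (intro Bochner_Integration.integral_sum) auto
  also have "\<dots> = (\<Sum>k\<in>K. \<integral>t. h (t + of_int k / b) \<partial>period_measure b)"
  proof (intro sum.cong refl)
    fix k
    have "(\<integral>t. indicator (I k) t *\<^sub>R h t \<partial>lborel) = (\<integral>t. indicator {0..<1/b} t *\<^sub>R h (t + of_int k / b) \<partial>lborel)"
      using lborel_integral_real_affine[of 1 "\<lambda>t. indicator (I k) t *\<^sub>R h t" "of_int k / b"] unfolding shift
      by (simp add: add.commute)
    also have "\<dots> = (\<integral>t. h (t + of_int k / b) \<partial>period_measure b)"
      by (rule integral_restrict_space[symmetric]) simp
    finally show "(\<integral>t. indicator (I k) t *\<^sub>R h t \<partial>lborel) = (\<integral>t. h (t + of_int k / b) \<partial>period_measure b)" .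
  qed
  finally show "(\<integral>t. h t \<partial>lborel) = (\<Sum>k\<in>K. \<integral>t. h (t + of_int k / b) \<partial>period_measure b)" .
qed

section \<open>Gabor coefficients as Fourier coefficients of fibers\<close>

context sech_gabor
begin

text \<open>The frame coefficient as an integral over \<open>lborel\<close>; as the window is real,
  only the modulation is conjugated.\<close>

definition gabor_coeff :: "(real \<Rightarrow> complex) \<Rightarrow> int \<Rightarrow> int \<Rightarrow> complex" where
  "gabor_coeff f n m = (\<integral>t. f t * of_real (w (t - of_int n * a)) * cnj (cis (2 * pi * b * of_int m * t)) \<partial>lborel)"

lemma borel_measurable_w [measurable]: "w \<in> borel_measurable borel"
  unfolding w_def[abs_def] by (intro borel_measurable_continuous_onI continuous_intros) simp

text \<open>The square of sech is the derivative of tanh, which has finite limits at both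
  ends.\<close>

lemma integrable_w_power2: "integrable lborel (\<lambda>t. (w (t - x))\<^sup>2)"
proof -
  have "set_integrable lborel (einterval (-\<infinity>) \<infinity>) (\<lambda>t::real. 1 - (tanh t)\<^sup>2)"
  proof (rule interval_integral_FTC_nonneg(1))
    show "((tanh \<circ> real_of_ereal) \<longlongrightarrow> 1) (at_left \<infinity>)"
      unfolding ereal_tendsto_simps by (rule tanh_real_at_top)
    show "((tanh \<circ> real_of_ereal) \<longlongrightarrow> -1) (at_right (-\<infinity>))"
      unfolding ereal_tendsto_simps by (rule tanh_real_at_bot)
    show "AE x in lborel. - \<infinity> < ereal x \<longrightarrow> ereal x < \<infinity> \<longrightarrow> 0 \<le> 1 - (tanh x)\<^sup>2"
    proof -
      have "(tanh x)\<^sup>2 \<le> 1" for x :: real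
        using tanh_real_bounds[of x] by (simp add: abs_square_le_1 abs_le_iff)
      then show ?thesis by simp
    qed
  qed (auto intro!: derivative_eq_intros continuous_intros)
  then have "integrable lborel (\<lambda>t::real. 1 - (tanh t)\<^sup>2)"
    by (simp add: set_integrable_def)
  from lborel_integrable_real_affine[OF this, of "pi * \<gamma>" 0]
  have "integrable lborel (\<lambda>t. sech_const\<^sup>2 * (1 - (tanh (pi * \<gamma> * t))\<^sup>2))"
    using \<gamma> by simp
  moreover have "(w t)\<^sup>2 = sech_const\<^sup>2 * (1 - (tanh (pi * \<gamma> * t))\<^sup>2)" for t
  proof -
    have "1 - (tanh x)\<^sup>2 = (1 / cosh x)\<^sup>2" for x :: real
    proof -
      have "1 - (tanh x)\<^sup>2 = ((cosh x)\<^sup>2 - (sinh x)\<^sup>2) / (cosh x)\<^sup>2"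
        by (simp add: tanh_def power_divide diff_divide_distrib)
      then show ?thesis by (simp add: hyperbolic_pythagoras power_divide)
    qed
    then show ?thesis by (simp only: w_def power_mult_distrib)
  qed
  ultimately have "integrable lborel (\<lambda>t. (w t)\<^sup>2)" by simp
  from lborel_integrable_real_affine[OF this, of 1 "- x"] show ?thesis by (simp add: add.commute)
qed

context
  fixes f :: "real \<Rightarrow> complex"
  assumes f [measurable]: "f \<in> borel_measurable borel" and f2: "integrable lborel (\<lambda>t. (cmod (f t))\<^sup>2)"
begin

lemma integrable_gabor: "integrable lborel (\<lambda>t. f t * of_real (w (t - x)) * cnj (cis (c * t)))"
proof (rule Bochner_Integration.integrable_bound)
  show "integrable lborel (\<lambda>t. (cmod (f t))\<^sup>2 + (w (t - x))\<^sup>2)"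
    using f2 integrable_w_power2 by simp
  have "y * z \<le> y\<^sup>2 + z\<^sup>2" if "0 \<le> y" "0 \<le> z" for y z :: real
    using sum_squares_bound[of y z] mult_nonneg_nonneg[OF that] by linarith
  then show "AE t in lborel. norm (f t * of_real (w (t - x)) * cnj (cis (c * t))) \<le> norm ((cmod (f t))\<^sup>2 + (w (t - x))\<^sup>2)"
    by (simp add: norm_mult w_nonneg)
  show "(\<lambda>t. f t * of_real (w (t - x)) * cnj (cis (c * t))) \<in> borel_measurable lborel"
    unfolding cis_cnj minus_mult_left by measurable
qed

context
  fixes K :: "int set"
  assumes K: "finite K" and supp: "\<And>t. \<lfloor>b * t\<rfloor> \<notin> K \<Longrightarrow> f t = 0"
begin

text \<open>On the base period this is the periodization of \<open>f\<close> times the window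
  shifted by \<open>n * a\<close>, and also row \<open>n\<close> of the sech matrix at
  \<open>t\<close> applied to the samples of \<open>f\<close>. Finiteness of \<open>K\<close> makes
  it a finite sum.\<close>

definition fiber :: "int \<Rightarrow> real \<Rightarrow> complex" where
  "fiber n t = (\<Sum>k\<in>K. of_real (w (t + of_int k / b - of_int n * a)) * f (t + of_int k / b))"

lemma borel_measurable_fiber [measurable]: "fiber n \<in> borel_measurable borel"
  unfolding fiber_def[abs_def] by measurable

lemma integrable_f_period: "integrable (period_measure b) (\<lambda>t. (cmod (f (t + of_int k / b)))\<^sup>2)"
  by (rule lborel_integral_split_period(1)[OF b f2 K]) (simp add: supp)

lemma norm_f_split:
  "(\<integral>t. (cmod (f t))\<^sup>2 \<partial>lborel) = (\<integral>t. (\<Sum>k\<in>K. (cmod (f (t + of_int k / b)))\<^sup>2) \<partial>period_measure b)"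
proof -
  have "(\<integral>t. (cmod (f t))\<^sup>2 \<partial>lborel) = (\<Sum>k\<in>K. \<integral>t. (cmod (f (t + of_int k / b)))\<^sup>2 \<partial>period_measure b)"
    by (rule lborel_integral_split_period(2)[OF b f2 K]) (simp add: supp)
  then show ?thesis using integrable_f_period by simp
qed

lemma integrable_sum_f_period: "integrable (period_measure b) (\<lambda>t. \<Sum>k\<in>K. (cmod (f (t + of_int k / b)))\<^sup>2)"
  using integrable_f_period by simp

lemma integrable_fiber: "integrable (period_measure b) (\<lambda>t. (cmod (fiber n t))\<^sup>2)"
proof (rule Bochner_Integration.integrable_bound)
  show "integrable (period_measure b) (\<lambda>t. upper_const * (\<Sum>k\<in>K. (cmod (f (t + of_int k / b)))\<^sup>2))"
    using integrable_sum_f_period by simp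
  show "AE t in period_measure b. norm ((cmod (fiber n t))\<^sup>2) \<le> norm (upper_const * (\<Sum>k\<in>K. (cmod (f (t + of_int k / b)))\<^sup>2))"
    using fiber_upper[OF K, of "{n}"] upper_const_nonneg
    by (intro AE_I2) (simp add: fiber_def abs_mult sum_nonneg)
  show "(\<lambda>t. (cmod (fiber n t))\<^sup>2) \<in> borel_measurable (period_measure b)"
    by (intro measurable_period) measurable
qed

text \<open>The modulation of frequency \<open>m * b\<close> has period \<open>1/b\<close>, so
  folding the integral leaves it outside the sum over \<open>k\<close>.\<close>

lemma gabor_coeff_eq_fourier_coeff: "gabor_coeff f n m = fourier_coeff b (fiber n) m"
proof -
  let ?h = "\<lambda>t. f t * of_real (w (t - of_int n * a)) * cnj (cis (2 * pi * b * of_int m * t))"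
  have z: "?h t = 0" if "\<lfloor>b * t\<rfloor> \<notin> K" for t using supp[OF that] by simp
  have int: "integrable lborel ?h" using integrable_gabor[of "of_int n * a" "2 * pi * b * of_int m"] .
  have per: "cis (2 * pi * b * of_int m * (t + of_int k / b)) = cis (2 * pi * b * of_int m * t)" for t and k :: int
  proof -
    have "2 * pi * b * of_int m * (t + of_int k / b) = 2 * pi * b * of_int m * t + 2 * pi * of_int (m * k)"
      using b by (simp add: field_simps)
    then show ?thesis by (simp only: cis_mult[symmetric] cis_multiple_2pi[OF Ints_of_int] mult_1_right)
  qed
  have "gabor_coeff f n m = (\<Sum>k\<in>K. \<integral>t. ?h (t + of_int k / b) \<partial>period_measure b)"
    unfolding gabor_coeff_def by (rule lborel_integral_split_period(2)[OF b int K z])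
  also have "\<dots> = (\<integral>t. (\<Sum>k\<in>K. ?h (t + of_int k / b)) \<partial>period_measure b)"
    by (rule Bochner_Integration.integral_sum[symmetric]) (rule lborel_integral_split_period(1)[OF b int K z])
  also have "\<dots> = fourier_coeff b (fiber n) m"
    unfolding fourier_coeff_def fiber_def per sum_distrib_right by (simp only: mult_ac)
  finally show ?thesis .
qed

text \<open>Bessel's inequality for each \<open>n\<close>, then the pointwise matrix bound
  \<open>fiber_upper\<close> integrated over the period.\<close>

lemma gabor_upper_compact_support:
  assumes "finite F1" "finite F2"
  shows "(\<Sum>n\<in>F1. \<Sum>m\<in>F2. (cmod (gabor_coeff f n m))\<^sup>2) \<le> upper_const / b * (\<integral>t. (cmod (f t))\<^sup>2 \<partial>lborel)"
proof -
  have "(\<Sum>n\<in>F1. \<Sum>m\<in>F2. (cmod (gabor_coeff f n m))\<^sup>2)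
      \<le> (\<Sum>n\<in>F1. 1 / b * (\<integral>t. (cmod (fiber n t))\<^sup>2 \<partial>period_measure b))"
    unfolding gabor_coeff_eq_fourier_coeff
    by (intro sum_mono bessel_inequality b borel_measurable_fiber integrable_fiber assms)
  also have "\<dots> = 1 / b * (\<integral>t. (\<Sum>n\<in>F1. (cmod (fiber n t))\<^sup>2) \<partial>period_measure b)"
    using integrable_fiber by (simp add: sum_distrib_left)
  also have "\<dots> \<le> 1 / b * (\<integral>t. upper_const * (\<Sum>k\<in>K. (cmod (f (t + of_int k / b)))\<^sup>2) \<partial>period_measure b)"
  proof (intro mult_left_mono integral_mono)
    show "(\<Sum>n\<in>F1. (cmod (fiber n t))\<^sup>2) \<le> upper_const * (\<Sum>k\<in>K. (cmod (f (t + of_int k / b)))\<^sup>2)" for t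
      unfolding fiber_def by (rule fiber_upper[OF K assms(1)])
  qed (use b integrable_fiber integrable_sum_f_period in auto)
  also have "\<dots> = upper_const / b * (\<integral>t. (cmod (f t))\<^sup>2 \<partial>lborel)"
    unfolding norm_f_split by simp
  finally show ?thesis .
qed

text \<open>Integrate \<open>fiber_lower\<close> over the period, then replace the norm of each
  fiber by finitely many Fourier coefficients at a total cost of at most \<open>e\<close>.\<close>

lemma gabor_lower_compact_support:
  assumes e: "0 < e"
  obtains F where "finite F"
    "(\<integral>t. (cmod (f t))\<^sup>2 \<partial>lborel) \<le> lower_const * b * ((\<Sum>(n, m)\<in>F. (cmod (gabor_coeff f n m))\<^sup>2) + e)"
proof -
  \<comment> \<open>Rounding is monotone, so these intervals contain every nearest index that occurs
    as \<open>t\<close> runs through the period; one finite set of rows serves all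
    \<open>t\<close>.\<close>
  define F1 where "F1 = (\<Union>k\<in>K. {round ((of_int k / b) / a)..round ((1 / b + of_int k / b) / a)})"
  have F1: "finite F1" unfolding F1_def using K by simp
  \<comment> \<open>The error is shared among the rows; the \<open>+ 1\<close> keeps the denominator
    positive when \<open>F1\<close> is empty.\<close>
  define e' where "e' = e / (real (card F1) + 1)"
  have e': "0 < e'" "real (card F1) * e' \<le> e" using e by (auto simp: e'_def field_simps)
  have "\<exists>G. finite G \<and> 1 / b * (\<integral>t. (cmod (fiber n t))\<^sup>2 \<partial>period_measure b) \<le> (\<Sum>m\<in>G. (cmod (gabor_coeff f n m))\<^sup>2) + e'" for n
    unfolding gabor_coeff_eq_fourier_coeff
    using parseval_approx[OF b borel_measurable_fiber integrable_fiber e'(1)] by metis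
  then obtain G where G: "\<And>n. finite (G n)"
    "\<And>n. 1 / b * (\<integral>t. (cmod (fiber n t))\<^sup>2 \<partial>period_measure b) \<le> (\<Sum>m\<in>G n. (cmod (gabor_coeff f n m))\<^sup>2) + e'"
    by metis
  have "(\<integral>t. (cmod (f t))\<^sup>2 \<partial>lborel) \<le> (\<integral>t. lower_const * (\<Sum>n\<in>F1. (cmod (fiber n t))\<^sup>2) \<partial>period_measure b)"
    unfolding norm_f_split
  proof (rule integral_mono)
    fix t assume "t \<in> space (period_measure b)"
    then have t: "0 \<le> t" "t < 1 / b" by (auto simp: space_restrict_space)
    have "round ((t + of_int k / b) / a) \<in> F1" if "k \<in> K" for k
    proof -
      have "round ((of_int k / b) / a) \<le> round ((t + of_int k / b) / a)"
        "round ((t + of_int k / b) / a) \<le> round ((1 / b + of_int k / b) / a)"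
        using t a by (intro round_mono divide_right_mono; simp)+
      then show ?thesis using that unfolding F1_def by auto
    qed
    then show "(\<Sum>k\<in>K. (cmod (f (t + of_int k / b)))\<^sup>2) \<le> lower_const * (\<Sum>n\<in>F1. (cmod (fiber n t))\<^sup>2)"
      unfolding fiber_def by (rule fiber_lower[OF K F1])
  qed (use integrable_fiber integrable_sum_f_period in auto)
  also have "\<dots> = lower_const * b * (\<Sum>n\<in>F1. 1 / b * (\<integral>t. (cmod (fiber n t))\<^sup>2 \<partial>period_measure b))"
    using integrable_fiber b by (simp flip: sum_divide_distrib)
  also have "\<dots> \<le> lower_const * b * (\<Sum>n\<in>F1. (\<Sum>m\<in>G n. (cmod (gabor_coeff f n m))\<^sup>2) + e')"
    using lower_const_pos b by (intro mult_left_mono sum_mono G(2)) auto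
  also have "\<dots> = lower_const * b * ((\<Sum>(n, m)\<in>Sigma F1 G. (cmod (gabor_coeff f n m))\<^sup>2) + real (card F1) * e')"
    using F1 G(1) by (simp add: sum.distrib sum.Sigma)
  also have "\<dots> \<le> lower_const * b * ((\<Sum>(n, m)\<in>Sigma F1 G. (cmod (gabor_coeff f n m))\<^sup>2) + e)"
    using lower_const_pos b e'(2) by (intro mult_left_mono add_left_mono) auto
  finally show ?thesis using F1 G(1) by (intro that[of "Sigma F1 G"]) auto
qed

end

end

end

text \<open>A Lebesgue measurable function agrees almost everywhere with a Borel one. Norm and inner
  products do not see the change, so the analysis above applies to all of \<open>L2\<close>.\<close>

lemma L2_borel_representative:
  assumes "f \<in> L2"
  obtains f' where "f' \<in> borel_measurable borel" "integrable lborel (\<lambda>t. (cmod (f' t))\<^sup>2)"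
    "(L2_norm f)\<^sup>2 = (\<integral>t. (cmod (f' t))\<^sup>2 \<partial>lborel)"
    "\<forall>g\<in>borel_measurable borel. L2_inner f g = (\<integral>t. f' t * cnj (g t) \<partial>lborel)"
proof -
  have f [measurable]: "f \<in> borel_measurable lebesgue" and f2: "integrable lebesgue (\<lambda>t. (cmod (f t))\<^sup>2)"
    using assms by (auto simp: L2_def)
  \<comment> \<open>Real and imaginary parts are treated separately because the Borel modification
    is taken for real functions.\<close>
  have "(\<lambda>t. Re (f t)) \<in> borel_measurable (completion lborel)" "(\<lambda>t. Im (f t)) \<in> borel_measurable (completion lborel)"
    by measurable
  from this[THEN completion_ex_borel_measurable_real]
  obtain r i where r: "r \<in> borel_measurable lborel" "AE t in lborel. Re (f t) = r t"
    and i: "i \<in> borel_measurable lborel" "AE t in lborel. Im (f t) = i t" by blast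
  define f' where "f' t = Complex (r t) (i t)" for t
  have f' [measurable]: "f' \<in> borel_measurable borel"
    using r(1) i(1) unfolding f'_def[abs_def] Complex_eq by simp
  have "AE t in lborel. f t = f' t"
    using r(2) i(2) by eventually_elim (simp add: f'_def complex_eq_iff)
  then have ae: "AE t in lebesgue. f t = f' t" by (rule AE_completion)
  have fl: "f' \<in> borel_measurable lebesgue" using f' by (intro measurable_completion) simp
  have sq: "integral\<^sup>L lebesgue (\<lambda>t. (cmod (f t))\<^sup>2) = integral\<^sup>L lebesgue (\<lambda>t. (cmod (f' t))\<^sup>2)"
    "integrable lebesgue (\<lambda>t. (cmod (f' t))\<^sup>2)"
  proof -
    have m: "(\<lambda>t. (cmod (f t))\<^sup>2) \<in> borel_measurable lebesgue" "(\<lambda>t. (cmod (f' t))\<^sup>2) \<in> borel_measurable lebesgue"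
      using f fl by (intro borel_measurable_power borel_measurable_norm; simp)+
    have e: "AE t in lebesgue. (cmod (f t))\<^sup>2 = (cmod (f' t))\<^sup>2" using ae by eventually_elim simp
    show "integral\<^sup>L lebesgue (\<lambda>t. (cmod (f t))\<^sup>2) = integral\<^sup>L lebesgue (\<lambda>t. (cmod (f' t))\<^sup>2)"
      by (rule integral_cong_AE[OF m e])
    show "integrable lebesgue (\<lambda>t. (cmod (f' t))\<^sup>2)"
      using f2 integrable_cong_AE[OF m e] by simp
  qed
  show ?thesis
  proof
    show "f' \<in> borel_measurable borel" by (rule f')
    show "integrable lborel (\<lambda>t. (cmod (f' t))\<^sup>2)"
      using sq(2) by (subst (asm) integrable_completion) simp_all
    have "(L2_norm f)\<^sup>2 = integral\<^sup>L lebesgue (\<lambda>t. (cmod (f t))\<^sup>2)"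
      unfolding L2_norm_def by (intro real_sqrt_pow2 integral_nonneg_AE) simp
    also have "\<dots> = (\<integral>t. (cmod (f' t))\<^sup>2 \<partial>lborel)"
      unfolding sq(1) by (rule integral_completion) simp
    finally show "(L2_norm f)\<^sup>2 = (\<integral>t. (cmod (f' t))\<^sup>2 \<partial>lborel)" .
    show "\<forall>g\<in>borel_measurable borel. L2_inner f g = (\<integral>t. f' t * cnj (g t) \<partial>lborel)"
    proof
      fix g :: "real \<Rightarrow> complex" assume g [measurable]: "g \<in> borel_measurable borel"
      have gl: "g \<in> borel_measurable lebesgue" using g by (intro measurable_completion) simp
      have cg: "(\<lambda>t. cnj (g t)) \<in> borel_measurable borel"
        using borel_measurable_continuous_on[OF continuous_on_cnj[OF continuous_on_id] g] by simp
      have cgl: "(\<lambda>t. cnj (g t)) \<in> borel_measurable lebesgue"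
        using cg by (intro measurable_completion) simp
      have "L2_inner f g = integral\<^sup>L lebesgue (\<lambda>t. f' t * cnj (g t))"
        unfolding L2_inner_def
      proof (rule integral_cong_AE)
        show "AE t in lebesgue. f t * cnj (g t) = f' t * cnj (g t)" using ae by eventually_elim simp
      qed (use f fl cgl in \<open>auto intro!: borel_measurable_times\<close>)
      also have "\<dots> = (\<integral>t. f' t * cnj (g t) \<partial>lborel)"
        using f' cg by (intro integral_completion) simp
      finally show "L2_inner f g = (\<integral>t. f' t * cnj (g t) \<partial>lborel)" .
    qed
  qed
qed

section \<open>Truncation and passage to general square integrable functions\<close>

context sech_gabor
begin

context
  fixes f :: "real \<Rightarrow> complex"
  assumes f [measurable]: "f \<in> borel_measurable borel" and f2: "integrable lborel (\<lambda>t. (cmod (f t))\<^sup>2)"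
begin

text \<open>The cut runs along whole periods, so the support condition holds with
  \<open>K = {- int N..<int N}\<close>.\<close>

definition trunc :: "nat \<Rightarrow> real \<Rightarrow> complex" where
  "trunc N t = indicator {- real N / b..<real N / b} t *\<^sub>R f t"

lemma borel_measurable_trunc [measurable]: "trunc N \<in> borel_measurable borel"
  unfolding trunc_def[abs_def] by measurable

lemma norm_trunc_le: "cmod (trunc N t) \<le> cmod (f t)"
  by (simp add: trunc_def indicator_def)

lemma trunc_tendsto: "(\<lambda>N. trunc N t) \<longlonglongrightarrow> f t"
proof (rule tendsto_eventually)
  obtain N0 where N0: "b * \<bar>t\<bar> < real N0" using reals_Archimedean2 by blast
  have "trunc N t = f t" if "N \<ge> N0" for N
  proof -
    have "\<bar>t\<bar> < real N / b" using N0 that b by (simp add: field_simps)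
    then show ?thesis by (auto simp: trunc_def indicator_def)
  qed
  then show "\<forall>\<^sub>F N in sequentially. trunc N t = f t" unfolding eventually_sequentially by blast
qed

lemma trunc_power2_le: "(cmod (trunc N t))\<^sup>2 \<le> (cmod (f t))\<^sup>2"
  by (intro power_mono norm_trunc_le) simp

lemma integrable_trunc: "integrable lborel (\<lambda>t. (cmod (trunc N t))\<^sup>2)"
  by (rule Bochner_Integration.integrable_bound[OF f2]) (simp_all add: trunc_power2_le)

lemma trunc_support: "\<lfloor>b * t\<rfloor> \<notin> {- int N..<int N} \<Longrightarrow> trunc N t = 0"
  using b by (auto simp: trunc_def indicator_def le_floor_iff floor_less_iff field_simps)

lemma trunc_diff_power2_le: "(cmod (trunc N t - f t))\<^sup>2 \<le> (cmod (f t))\<^sup>2"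
  by (simp add: trunc_def indicator_def)

lemma integrable_trunc_diff: "integrable lborel (\<lambda>t. (cmod (trunc N t - f t))\<^sup>2)"
  by (rule Bochner_Integration.integrable_bound[OF f2]) (simp_all add: trunc_diff_power2_le)

lemma norm_trunc_tendsto: "(\<lambda>N. \<integral>t. (cmod (trunc N t))\<^sup>2 \<partial>lborel) \<longlonglongrightarrow> (\<integral>t. (cmod (f t))\<^sup>2 \<partial>lborel)"
  by (rule integral_dominated_convergence[OF _ _ f2])
    (auto simp: trunc_power2_le intro!: tendsto_intros trunc_tendsto)

lemma norm_trunc_diff_tendsto: "(\<lambda>N. \<integral>t. (cmod (trunc N t - f t))\<^sup>2 \<partial>lborel) \<longlonglongrightarrow> 0"
proof -
  have "(\<lambda>N. \<integral>t. (cmod (trunc N t - f t))\<^sup>2 \<partial>lborel) \<longlonglongrightarrow> (\<integral>t. 0 \<partial>(lborel :: real measure))"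
  proof (rule integral_dominated_convergence[OF _ _ f2])
    have "(\<lambda>N. (cmod (trunc N t - f t))\<^sup>2) \<longlonglongrightarrow> (cmod (f t - f t))\<^sup>2" for t
      by (intro tendsto_intros trunc_tendsto)
    then show "AE t in lborel. (\<lambda>N. (cmod (trunc N t - f t))\<^sup>2) \<longlonglongrightarrow> 0" by simp
  qed (auto simp: trunc_diff_power2_le)
  then show ?thesis by simp
qed

lemma gabor_coeff_trunc_tendsto: "(\<lambda>N. gabor_coeff (trunc N) n m) \<longlonglongrightarrow> gabor_coeff f n m"
  unfolding gabor_coeff_def
proof (rule integral_dominated_convergence[OF _ _ integrable_norm[OF integrable_gabor[OF f f2]]])
  show "AE t in lborel. (\<lambda>N. trunc N t * of_real (w (t - of_int n * a)) * cnj (cis (2 * pi * b * of_int m * t)))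
      \<longlonglongrightarrow> f t * of_real (w (t - of_int n * a)) * cnj (cis (2 * pi * b * of_int m * t))"
    by (intro AE_I2 tendsto_intros trunc_tendsto)
  show "AE t in lborel. norm (trunc N t * of_real (w (t - of_int n * a)) * cnj (cis (2 * pi * b * of_int m * t)))
      \<le> norm (f t * of_real (w (t - of_int n * a)) * cnj (cis (2 * pi * b * of_int m * t)))" for N
    by (intro AE_I2) (simp add: norm_mult mult_right_mono norm_trunc_le)
qed (intro borel_measurable_integrable integrable_gabor f f2 borel_measurable_trunc integrable_trunc)+

text \<open>\<open>F\<close> lies in a finite rectangle, where the bound holds for every truncation.
  A finite sum passes to the limit term by term.\<close>

lemma gabor_upper:
  assumes "finite F"
  shows "(\<Sum>(n, m)\<in>F. (cmod (gabor_coeff f n m))\<^sup>2) \<le> upper_const / b * (\<integral>t. (cmod (f t))\<^sup>2 \<partial>lborel)"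
proof (rule LIMSEQ_le_const2)
  show "(\<lambda>N. \<Sum>(n, m)\<in>F. (cmod (gabor_coeff (trunc N) n m))\<^sup>2) \<longlonglongrightarrow> (\<Sum>(n, m)\<in>F. (cmod (gabor_coeff f n m))\<^sup>2)"
    unfolding case_prod_beta by (intro tendsto_intros gabor_coeff_trunc_tendsto)
  have "(\<Sum>(n, m)\<in>F. (cmod (gabor_coeff (trunc N) n m))\<^sup>2) \<le> upper_const / b * (\<integral>t. (cmod (f t))\<^sup>2 \<partial>lborel)" for N
  proof -
    have "(\<Sum>(n, m)\<in>F. (cmod (gabor_coeff (trunc N) n m))\<^sup>2) \<le> (\<Sum>(n, m)\<in>fst ` F \<times> snd ` F. (cmod (gabor_coeff (trunc N) n m))\<^sup>2)"
      using assms by (intro sum_mono2) (force intro: finite_imageI)+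
    also have "\<dots> = (\<Sum>n\<in>fst ` F. \<Sum>m\<in>snd ` F. (cmod (gabor_coeff (trunc N) n m))\<^sup>2)"
      by (simp add: sum.cartesian_product)
    also have "\<dots> \<le> upper_const / b * (\<integral>t. (cmod (trunc N t))\<^sup>2 \<partial>lborel)"
      using assms trunc_support
      by (intro gabor_upper_compact_support[OF borel_measurable_trunc integrable_trunc, where K = "{- int N..<int N}"]) simp_all
    also have "\<dots> \<le> upper_const / b * (\<integral>t. (cmod (f t))\<^sup>2 \<partial>lborel)"
      using upper_const_nonneg b
      by (intro mult_left_mono integral_mono integrable_trunc f2 trunc_power2_le divide_nonneg_nonneg) auto
    finally show ?thesis .
  qed
  then show "\<exists>N0. \<forall>N\<ge>N0. (\<Sum>(n, m)\<in>F. (cmod (gabor_coeff (trunc N) n m))\<^sup>2) \<le> upper_const / b * (\<integral>t. (cmod (f t))\<^sup>2 \<partial>lborel)"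
    by blast
qed

end

text \<open>The finite set obtained for a truncation varies with \<open>N\<close>, so termwise
  limits do not suffice. Instead the coefficients of the truncation are split into those of
  \<open>f\<close>, bounded through \<open>S\<close>, and those of the remainder, which the upper
  bound makes vanish in the limit. The inequality for the square of a sum costs the factor
  2.\<close>

lemma gabor_lower:
  assumes f [measurable]: "f \<in> borel_measurable borel" and f2: "integrable lborel (\<lambda>t. (cmod (f t))\<^sup>2)"
    and S: "\<And>F. finite F \<Longrightarrow> (\<Sum>(n, m)\<in>F. (cmod (gabor_coeff f n m))\<^sup>2) \<le> S"
  shows "(\<integral>t. (cmod (f t))\<^sup>2 \<partial>lborel) \<le> lower_const * b * (2 * S)"
proof (rule LIMSEQ_le)
  let ?f = "trunc f"
  let ?D = "\<lambda>N. \<integral>t. (cmod (?f N t - f t))\<^sup>2 \<partial>lborel"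
  show "(\<lambda>N. \<integral>t. (cmod (?f N t))\<^sup>2 \<partial>lborel) \<longlonglongrightarrow> (\<integral>t. (cmod (f t))\<^sup>2 \<partial>lborel)"
    by (rule norm_trunc_tendsto[OF f f2])
  have "(\<lambda>N. lower_const * b * (2 * S + 2 * (upper_const / b * ?D N))) \<longlonglongrightarrow> lower_const * b * (2 * S + 2 * (upper_const / b * 0))"
    by (intro tendsto_intros norm_trunc_diff_tendsto[OF f f2])
  then show "(\<lambda>N. lower_const * b * (2 * S + 2 * (upper_const / b * ?D N))) \<longlonglongrightarrow> lower_const * b * (2 * S)" by simp
  have "(\<integral>t. (cmod (?f N t))\<^sup>2 \<partial>lborel) \<le> lower_const * b * (2 * S + 2 * (upper_const / b * ?D N))" for N
  proof (rule field_le_epsilon)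
    fix e :: real assume e: "0 < e"
    \<comment> \<open>Chosen so that multiplication by \<open>lower_const * b\<close> returns
      \<open>e\<close>.\<close>
    define e' where "e' = e / (lower_const * b)"
    have e': "0 < e'" using e b lower_const_pos by (simp add: e'_def)
    note tm = borel_measurable_trunc[OF f f2, of N] and ti = integrable_trunc[OF f f2, of N]
      and di = integrable_trunc_diff[OF f f2, of N]
    have dm: "(\<lambda>t. ?f N t - f t) \<in> borel_measurable borel" using tm f by (rule borel_measurable_diff)
    obtain F where F: "finite F"
      "(\<integral>t. (cmod (?f N t))\<^sup>2 \<partial>lborel) \<le> lower_const * b * ((\<Sum>(n, m)\<in>F. (cmod (gabor_coeff (?f N) n m))\<^sup>2) + e')"
      using gabor_lower_compact_support[OF tm ti, of "{- int N..<int N}" e'] trunc_support[OF f f2] e' by auto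
    have split: "gabor_coeff (?f N) n m = gabor_coeff f n m + gabor_coeff (\<lambda>t. ?f N t - f t) n m" for n m
    proof -
      have "gabor_coeff (\<lambda>t. ?f N t - f t) n m = gabor_coeff (?f N) n m - gabor_coeff f n m"
        unfolding gabor_coeff_def left_diff_distrib
        by (rule Bochner_Integration.integral_diff[OF integrable_gabor[OF tm ti] integrable_gabor[OF f f2]])
      then show ?thesis by simp
    qed
    have "(\<Sum>(n, m)\<in>F. (cmod (gabor_coeff (?f N) n m))\<^sup>2)
        \<le> (\<Sum>(n, m)\<in>F. 2 * (cmod (gabor_coeff f n m))\<^sup>2 + 2 * (cmod (gabor_coeff (\<lambda>t. ?f N t - f t) n m))\<^sup>2)"
      unfolding split case_prod_beta by (intro sum_mono norm_add_power2_le)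
    also have "\<dots> = 2 * (\<Sum>(n, m)\<in>F. (cmod (gabor_coeff f n m))\<^sup>2) + 2 * (\<Sum>(n, m)\<in>F. (cmod (gabor_coeff (\<lambda>t. ?f N t - f t) n m))\<^sup>2)"
      unfolding case_prod_beta by (simp add: sum.distrib sum_distrib_left)
    also have "\<dots> \<le> 2 * S + 2 * (upper_const / b * ?D N)"
      by (intro add_mono mult_left_mono S gabor_upper[OF dm di] F(1)) auto
    finally have "lower_const * b * ((\<Sum>(n, m)\<in>F. (cmod (gabor_coeff (?f N) n m))\<^sup>2) + e')
        \<le> lower_const * b * ((2 * S + 2 * (upper_const / b * ?D N)) + e')"
      using lower_const_pos b by (intro mult_left_mono add_right_mono) auto
    also have "\<dots> = lower_const * b * (2 * S + 2 * (upper_const / b * ?D N)) + e"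
      using lower_const_pos b by (simp add: e'_def distrib_left)
    finally show "(\<integral>t. (cmod (?f N t))\<^sup>2 \<partial>lborel) \<le> lower_const * b * (2 * S + 2 * (upper_const / b * ?D N)) + e"
      using F(2) by linarith
  qed
  then show "\<exists>N0. \<forall>N\<ge>N0. (\<integral>t. (cmod (?f N t))\<^sup>2 \<partial>lborel) \<le> lower_const * b * (2 * S + 2 * (upper_const / b * ?D N))"
    by blast
qed

section \<open>The frame inequality for the hyperbolic secant window\<close>

lemma sech_window_L2: "sech_window \<gamma> \<in> L2"
proof -
  have 1: "sech_window \<gamma> \<in> borel_measurable borel"
    unfolding sech_window_eq[abs_def] by measurable
  have "integrable lborel (\<lambda>t. (cmod (sech_window \<gamma> t))\<^sup>2)"
    using integrable_w_power2[of 0] by (simp add: sech_window_eq)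
  then have "integrable lebesgue (\<lambda>t. (cmod (sech_window \<gamma> t))\<^sup>2)"
    using 1 by (subst integrable_completion) simp_all
  with 1 show ?thesis
    unfolding L2_def by (auto intro: measurable_completion)
qed

lemma tf_shift_sech_window:
  "tf_shift (sech_window \<gamma>) (of_int n * a) (of_int m * b) t
    = cis (2 * pi * b * of_int m * t) * of_real (w (t - of_int n * a))"
proof -
  have "2 * of_real pi * \<i> * of_real (of_int m * b) * of_real t = \<i> * of_real (2 * pi * b * of_int m * t)"
    by simp
  then show ?thesis by (simp only: tf_shift_def sech_window_eq cis_conv_exp)
qed

lemma gabor_frame_sech_window: "gabor_frame (sech_window \<gamma>) a b"
  unfolding gabor_frame_def
\<comment> \<open>The frame bounds stay schematic here; the goals below fix
  \<open>A = 1 / (lower_const * b * 2)\<close> and \<open>B = upper_const / b\<close>.\<close>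
proof (intro conjI sech_window_L2 exI ballI)
  show "0 < 1 / (lower_const * b * 2)" using lower_const_pos b by simp
  fix f assume fL2: "f \<in> L2"
  obtain f' where f': "f' \<in> borel_measurable borel" "integrable lborel (\<lambda>t. (cmod (f' t))\<^sup>2)"
    "(L2_norm f)\<^sup>2 = (\<integral>t. (cmod (f' t))\<^sup>2 \<partial>lborel)"
    "\<forall>g\<in>borel_measurable borel. L2_inner f g = (\<integral>t. f' t * cnj (g t) \<partial>lborel)"
    using L2_borel_representative[OF fL2] by blast
  have coeff: "L2_inner f (tf_shift (sech_window \<gamma>) (of_int n * a) (of_int m * b)) = gabor_coeff f' n m" for n m
  proof -
    have "tf_shift (sech_window \<gamma>) (of_int n * a) (of_int m * b) \<in> borel_measurable borel"
      unfolding tf_shift_sech_window[abs_def] by measurable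
    from f'(4)[rule_format, OF this] show ?thesis
      unfolding tf_shift_sech_window gabor_coeff_def by (simp only: complex_cnj_mult complex_cnj_complex_of_real mult.assoc mult.commute mult.left_commute)
  qed
  let ?X = "\<lambda>(n, m). (cmod (gabor_coeff f' n m))\<^sup>2"
  note upper = gabor_upper[OF f'(1,2), folded f'(3)]
  \<comment> \<open>Terms are nonnegative and the finite partial sums are bounded by the upper frame
    bound.\<close>
  have sum: "?X summable_on UNIV"
    by (rule nonneg_bdd_above_summable_on) (auto intro!: bdd_aboveI2 upper)
  have "(L2_norm f)\<^sup>2 \<le> lower_const * b * (2 * infsum ?X UNIV)"
    \<comment> \<open>Here \<open>S\<close> is the full double sum, which dominates all finite
      partial sums.\<close>
    unfolding f'(3) by (rule gabor_lower[OF f'(1,2)]) (auto intro!: finite_sum_le_infsum sum)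
  then show "1 / (lower_const * b * 2) * (L2_norm f)\<^sup>2
      \<le> (\<Sum>\<^sub>\<infinity>(n::int, m::int)\<in>UNIV. (cmod (L2_inner f (tf_shift (sech_window \<gamma>) (of_int n * a) (of_int m * b))))\<^sup>2)"
    unfolding coeff using lower_const_pos b by (simp add: field_simps)
  show "(\<lambda>(n::int, m::int). (cmod (L2_inner f (tf_shift (sech_window \<gamma>) (of_int n * a) (of_int m * b))))\<^sup>2) summable_on UNIV"
    unfolding coeff by (rule sum)
  show "(\<Sum>\<^sub>\<infinity>(n::int, m::int)\<in>UNIV. (cmod (L2_inner f (tf_shift (sech_window \<gamma>) (of_int n * a) (of_int m * b))))\<^sup>2)
      \<le> upper_const / b * (L2_norm f)\<^sup>2"
    unfolding coeff by (rule infsum_le_finite_sums[OF sum]) (rule upper)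
qed

end

theorem mainTheorem1:
  fixes \<gamma> a b :: real
  assumes "\<gamma> > 0" and "a > 0" and "b > 0" and "a * b < 1"
  shows "gabor_frame (sech_window \<gamma>) a b"
  using assms by (intro sech_gabor.gabor_frame_sech_window sech_gabor.intro)

end
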